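(* Let $\mu$ be a symmetric freely infinitely divisible (FID) probability measure on $\mathbb{R}$ satisfying one of the following conditions: (1) $F_\mu$ extends to a univalent function around $i\mathbb{R}$ and it maps $i\mathbb{R}$ onto $i(0,\infty)$; (2) $F_\mu$ extends to a univalent function around $i(c,\infty)$ for some $c\in(-\infty,0]$ and it maps $i(c,\infty)$ onto $i(0,\infty)$, and moreover $F_\mu'(ic+i0)=0$, i.e. $\lim_{y\searrow c}F_\mu'(iy)=0$. Then the free divisibility indicator of $\mu$ is $1$.
   Context: "Univalent around a set" means analytic and injective in an open neighborhood of that set (the extension being an analytic continuation of $F_\mu$ near $i(0,\infty)$). For a Borel probability measure $\mu$ on $\mathbb{R}$ let $G_\mu(z)=\int_{\mathbb{R}}\frac{1}{z-x}\mu(dx)$ and $F_\mu(z)=1/G_\mu(z)$ for $z\in\mathbb{C}^+$. On a truncated cone $\Gamma_{\lambda,M}=\{z\in\mathbb{C}^+: \mathrm{Im}\,z>M,\ |\mathrm{Re}\,z|<\lambda\,\mathrm{Im}\,z\}$ with $M$ large, $F_\mu$ has a right compositional inverse $F_\mu^{-1}$, and the Voiculescu transform is $\phi_\mu(z)=F_\mu^{-1}(z)-z$. The free additive convolution $\mu\boxplus\nu$ is the unique probability measure with $\phi_{\mu\boxplus\nu}=\phi_\mu+\phi_\nu$ on a common truncated cone; $\mu$ is FID if for each $n\in\{1,2,3,\dots\}$ there is a probability measure $\mu_n$ with $\mu=\mu_n\boxplus\cdots\boxplus\mu_n$ ($n$ times). For $s\ge1$, $\mu^{\boxplus s}$ is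 the probability measure with $\phi_{\mu^{\boxplus s}}=s\phi_\mu$ on some $\Gamma_{\lambda,M}$ (it always exists). For $t\geq 0$, the Boolean power $\mu^{\uplus t}$ is the probability measure defined by $F_{\mu^{\uplus t}}(z) = (1-t)z + tF_\mu(z)$. Let $\mathcal{P}$ be the set of Borel probability measures on $\mathbb{R}$ and, for $t\ge 0$, $\mathbb{B}_t(\mu) := \left(\mu^{\boxplus (1+t)}\right) ^{\uplus\frac{1}{1+t}}$ for $\mu\in\mathcal{P}$. The free divisibility indicator is $\phi(\mu):=\sup \{t \geq 0: \mu \in \mathbb{B}_t(\mathcal{P}) \}\in[0,\infty]$. *)

theory Defs
  imports "HOL-Probability.Probability"
begin

text \<open>Borel probability measures on the real line are the measures \<open>\<mu>\<close> with
  \<open>real_distribution \<mu>\<close>.\<close>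

definition cauchy_transform :: "real measure \<Rightarrow> complex \<Rightarrow> complex" where
  "cauchy_transform \<mu> z = (LINT x|\<mu>. 1 / (z - complex_of_real x))"

definition F_transform :: "real measure \<Rightarrow> complex \<Rightarrow> complex" where
  "F_transform \<mu> z = 1 / cauchy_transform \<mu> z"

definition trunc_cone :: "real \<Rightarrow> real \<Rightarrow> complex set" where
  "trunc_cone l M = {z. Im z > 0 \<and> Im z > M \<and> \<bar>Re z\<bar> < l * Im z}"

text \<open>Right inverses of \<open>F\<close> on a truncated cone are not unique without a normalization: for
  \<open>F z = z - 1 / z\<close> both solutions \<open>w\<close> of \<open>F w = z\<close> can lie in the upper half-plane. The inverse
  meant in the definition of the Voiculescu transform is the branch asymptotic to the identity
  at infinity, i.e. the inverse of the restriction of \<open>F\<close> to a truncated cone on which \<open>F\<close> is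
  injective.\<close>

definition is_F_inverse :: "real measure \<Rightarrow> real \<Rightarrow> real \<Rightarrow> (complex \<Rightarrow> complex) \<Rightarrow> bool" where
  "is_F_inverse \<mu> l M H \<longleftrightarrow>
     H holomorphic_on trunc_cone l M \<and>
     (\<forall>z\<in>trunc_cone l M. Im (H z) > 0 \<and> F_transform \<mu> (H z) = z) \<and>
     ((\<lambda>z. H z / z) \<longlongrightarrow> 1) (inf at_infinity (principal (trunc_cone l M)))"

definition is_voiculescu :: "real measure \<Rightarrow> real \<Rightarrow> real \<Rightarrow> (complex \<Rightarrow> complex) \<Rightarrow> bool" where
  "is_voiculescu \<mu> l M f \<longleftrightarrow>
     (\<exists>H. is_F_inverse \<mu> l M H \<and> (\<forall>z\<in>trunc_cone l M. f z = H z - z))"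

text \<open>The convolutions and powers exist and are unique for the parameters considered; they are
  represented by their graphs, the last argument being the resulting measure.\<close>

definition is_free_conv :: "real measure \<Rightarrow> real measure \<Rightarrow> real measure \<Rightarrow> bool" where
  "is_free_conv \<mu> \<nu> \<rho> \<longleftrightarrow> real_distribution \<rho> \<and>
     (\<exists>l>0. \<exists>M>0. \<exists>f g h. is_voiculescu \<mu> l M f \<and> is_voiculescu \<nu> l M g \<and> is_voiculescu \<rho> l M h \<and>
        (\<forall>z\<in>trunc_cone l M. h z = f z + g z))"

inductive is_free_conv_iter :: "real measure \<Rightarrow> nat \<Rightarrow> real measure \<Rightarrow> bool" for \<mu> where
  one: "is_free_conv_iter \<mu> 1 \<mu>"
| Suc: "is_free_conv_iter \<mu> n \<sigma> \<Longrightarrow> is_free_conv \<sigma> \<mu> \<rho> \<Longrightarrow> is_free_conv_iter \<mu> (Suc n) \<rho>"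

definition FID :: "real measure \<Rightarrow> bool" where
  "FID \<mu> \<longleftrightarrow> (\<forall>n\<ge>1. \<exists>\<nu>. real_distribution \<nu> \<and> is_free_conv_iter \<nu> n \<mu>)"

definition is_free_power :: "real measure \<Rightarrow> real \<Rightarrow> real measure \<Rightarrow> bool" where
  "is_free_power \<mu> s \<rho> \<longleftrightarrow> real_distribution \<rho> \<and>
     (\<exists>l>0. \<exists>M>0. \<exists>f h. is_voiculescu \<mu> l M f \<and> is_voiculescu \<rho> l M h \<and>
        (\<forall>z\<in>trunc_cone l M. h z = complex_of_real s * f z))"

definition is_boolean_power :: "real measure \<Rightarrow> real \<Rightarrow> real measure \<Rightarrow> bool" where
  "is_boolean_power \<mu> t \<rho> \<longleftrightarrow> real_distribution \<rho> \<and>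
     (\<forall>z. Im z > 0 \<longrightarrow>
        F_transform \<rho> z = (1 - complex_of_real t) * z + complex_of_real t * F_transform \<mu> z)"

definition is_BB :: "real \<Rightarrow> real measure \<Rightarrow> real measure \<Rightarrow> bool" where
  "is_BB t \<mu> \<rho> \<longleftrightarrow> (\<exists>\<nu>. is_free_power \<mu> (1 + t) \<nu> \<and> is_boolean_power \<nu> (1 / (1 + t)) \<rho>)"

definition BB_range :: "real \<Rightarrow> real measure set" where
  "BB_range t = {\<rho>. \<exists>\<mu>. real_distribution \<mu> \<and> is_BB t \<mu> \<rho>}"

definition free_div_indicator :: "real measure \<Rightarrow> ennreal" where
  "free_div_indicator \<mu> = (SUP t\<in>{t::real. t \<ge> 0 \<and> \<mu> \<in> BB_range t}. ennreal t)"

definition symmetric_measure :: "real measure \<Rightarrow> bool" where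
  "symmetric_measure \<mu> \<longleftrightarrow> distr \<mu> borel uminus = \<mu>"

definition univalent_around :: "(complex \<Rightarrow> complex) \<Rightarrow> complex set \<Rightarrow> bool" where
  "univalent_around f A \<longleftrightarrow> (\<exists>U. open U \<and> A \<subseteq> U \<and> f holomorphic_on U \<and> inj_on f U)"

definition imag_line :: "real set \<Rightarrow> complex set" where
  "imag_line S = (\<lambda>y. \<i> * complex_of_real y) ` S"

text \<open>\<open>f\<close> continues \<open>F\<close> analytically: the two agree on a neighbourhood of the positive
  imaginary half-axis (elsewhere in the upper half-plane no agreement is required).\<close>

definition extends_F :: "(complex \<Rightarrow> complex) \<Rightarrow> real measure \<Rightarrow> bool" where
  "extends_F f \<mu> \<longleftrightarrow>
     (\<exists>V. open V \<and> imag_line {0<..} \<subseteq> V \<and> (\<forall>z\<in>V. Im z > 0 \<longrightarrow> f z = F_transform \<mu> z))"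

end

theory Submission
  imports Defs "HOL-Real_Asymp.Real_Asymp" "HOL-Complex_Analysis.Complex_Analysis"
begin

text \<open>If \<open>\<mu> = \<B>\<^sub>t \<nu>\<close>, then \<open>\<Omega> z = t F\<^sub>\<mu> z - (t - 1) z\<close> has the holomorphic left inverse
  \<open>w \<mapsto> (1 + t) w - t F\<^sub>\<nu> w\<close> on the upper half-plane. The hypotheses keep \<open>\<Omega>\<close> inside the upper
  half-plane all along the extended part of the imaginary axis, so by analytic continuation
  \<open>y \<mapsto> Im (\<Omega> (i y))\<close> is injective there. It tends to infinity with \<open>y\<close>, but for \<open>t > 1\<close> it
  decreases somewhere near the left end: in case (1) because \<open>- (t - 1) y\<close> grows as \<open>y\<close> tends to
  \<open>-\<infinity>\<close>, in case (2) because its derivative tends to \<open>- (t - 1)\<close>. Hence \<open>t \<le> 1\<close>.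

  Conversely, if \<open>\<mu>\<close> is the \<open>n\<close>-fold free convolution power of \<open>\<nu>\<close>, then \<open>\<mu> = \<B>\<^sub>t N\<close> for
  \<open>t = 1 - 1/n\<close> and \<open>N\<close> the Boolean power of \<open>\<nu>\<close> of order \<open>n\<close>, so that no Levy-Khintchine
  representation is needed. Boolean powers exist because a holomorphic map \<open>G\<close> of the upper
  half-plane to the lower one with \<open>|G z| \<le> 1 / Im z\<close> and \<open>i y G (i y) \<longrightarrow> 1\<close> is a Cauchy transform:
  the densities \<open>- Im (G (x + i \<epsilon>)) / \<pi>\<close> are tight, and any weak limit point works.\<close>


subsection \<open>Cauchy transforms\<close>

context real_distribution
begin

lemma prob_UNIV: "prob UNIV = 1"
  using prob_space by simp

lemma norm_cauchy_kernel_le: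
  assumes "Im z > 0"
  shows "norm (1 / (z - complex_of_real x)) \<le> 1 / Im z"
proof -
  have "Im z \<le> norm (z - complex_of_real x)"
    using abs_Im_le_cmod[of "z - complex_of_real x"] by simp
  then show ?thesis
    using assms by (simp add: norm_divide frac_le)
qed

lemma integrable_cauchy_kernel [simp]:
  assumes "Im z > 0"
  shows "integrable M (\<lambda>x. 1 / (z - complex_of_real x))"
proof (rule integrable_const_bound[where B = "1 / Im z"])
  show "AE x in M. norm (1 / (z - complex_of_real x)) \<le> 1 / Im z"
    using norm_cauchy_kernel_le[OF assms] by auto
qed simp

lemma integrable_cauchy_kernel_mult [simp]:
  assumes "Im z > 0" "Im w > 0"
  shows "integrable M (\<lambda>x. 1 / ((z - complex_of_real x) * (w - complex_of_real x)))"
proof (rule integrable_const_bound[where B = "1 / Im z * (1 / Im w)"])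
  have "norm (1 / ((z - complex_of_real x) * (w - complex_of_real x))) \<le> 1 / Im z * (1 / Im w)" for x
  proof -
    have "norm (1 / (z - complex_of_real x) * (1 / (w - complex_of_real x))) \<le> 1 / Im z * (1 / Im w)"
      unfolding norm_mult
      by (intro mult_mono norm_cauchy_kernel_le assms) (use assms in auto)
    then show ?thesis by simp
  qed
  then show "AE x in M. norm (1 / ((z - complex_of_real x) * (w - complex_of_real x))) \<le> 1 / Im z * (1 / Im w)"
    by auto
qed simp

lemma minus_of_real_neq_0:
  assumes "Im z > 0" shows "z - complex_of_real x \<noteq> 0"
  using assms by (auto simp: complex_eq_iff)

text \<open>This is the resolvent identity integrated over the measure. It yields both the complex
  derivative of the transform and the injectivity of \<open>F_transform\<close> far up in a
  cone.\<close>

lemma cauchy_transform_diff: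
  assumes "Im z > 0" "Im w > 0"
  shows "cauchy_transform M z - cauchy_transform M w =
    (w - z) * (LINT x|M. 1 / ((z - complex_of_real x) * (w - complex_of_real x)))"
proof -
  have "cauchy_transform M z - cauchy_transform M w =
      (LINT x|M. 1 / (z - complex_of_real x) - 1 / (w - complex_of_real x))"
    unfolding cauchy_transform_def using assms by simp
  also have "\<dots> = (LINT x|M. (w - z) * (1 / ((z - complex_of_real x) * (w - complex_of_real x))))"
    using minus_of_real_neq_0[OF assms(1)] minus_of_real_neq_0[OF assms(2)]
    by (intro Bochner_Integration.integral_cong) (auto simp: divide_simps)
  finally show ?thesis by (simp only: integral_mult_right_zero)
qed

text \<open>The difference of the two integrands is \<open>z - w\<close> times three Cauchy kernels,
  each bounded by the reciprocal imaginary part of its point.\<close>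

lemma norm_kernel_square_integral_diff_le:
  assumes "Im z > 0" "Im w > 0"
  shows "norm ((LINT x|M. 1 / ((w - complex_of_real x) * (z - complex_of_real x))) -
               (LINT x|M. 1 / ((z - complex_of_real x) * (z - complex_of_real x))))
         \<le> norm (w - z) * (1 / Im w * (1 / Im z * (1 / Im z)))"
proof -
  have "(LINT x|M. 1 / ((w - complex_of_real x) * (z - complex_of_real x))) -
               (LINT x|M. 1 / ((z - complex_of_real x) * (z - complex_of_real x))) =
        (LINT x|M. 1 / ((w - complex_of_real x) * (z - complex_of_real x)) - 1 / ((z - complex_of_real x) * (z - complex_of_real x)))"
    using assms by simp
  also have "norm \<dots> \<le> (LINT x|M. norm (w - z) * (1 / Im w * (1 / Im z * (1 / Im z))))"
  proof (rule order_trans[OF integral_norm_bound], intro integral_mono)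
    fix x
    have "1 / ((w - complex_of_real x) * (z - complex_of_real x)) - 1 / ((z - complex_of_real x) * (z - complex_of_real x))
        = (z - w) * (1 / (w - complex_of_real x) * (1 / (z - complex_of_real x) * (1 / (z - complex_of_real x))))"
    proof -
      define a b where "a = z - complex_of_real x" and "b = w - complex_of_real x"
      have "a \<noteq> 0" "b \<noteq> 0" "z - w = a - b"
        using minus_of_real_neq_0 assms by (auto simp: a_def b_def)
      then show ?thesis
        unfolding a_def[symmetric] b_def[symmetric] by (simp add: divide_simps)
    qed
    also have "norm \<dots> \<le> norm (w - z) * (1 / Im w * (1 / Im z * (1 / Im z)))"
      unfolding norm_mult norm_minus_commute[of z w]
      by (intro mult_mono norm_cauchy_kernel_le assms mult_nonneg_nonneg norm_ge_zero) (use assms in auto)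
    finally show "norm (1 / ((w - complex_of_real x) * (z - complex_of_real x)) - 1 / ((z - complex_of_real x) * (z - complex_of_real x)))
      \<le> norm (w - z) * (1 / Im w * (1 / Im z * (1 / Im z)))" .
  qed (use assms in auto)
  finally show ?thesis by (simp add: prob_UNIV)
qed

text \<open>The resolvent identity turns the difference quotient into \<open>- J w\<close>, so
  differentiability at \<open>z\<close> reduces to continuity of \<open>J\<close> there.\<close>

lemma cauchy_transform_has_field_derivative:
  assumes "Im z > 0"
  shows "(cauchy_transform M has_field_derivative
      - (LINT x|M. 1 / ((z - complex_of_real x) * (z - complex_of_real x)))) (at z)"
proof -
  define J where "J w = (LINT x|M. 1 / ((w - complex_of_real x) * (z - complex_of_real x)))" for w
  have ev: "\<forall>\<^sub>F w in at z. Im w > 0"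
    using order_tendstoD(1)[OF tendsto_Im[OF tendsto_ident_at] assms] .
  have "((\<lambda>w. J w - J z) \<longlongrightarrow> 0) (at z)"
  proof (rule Lim_null_comparison)
    show "\<forall>\<^sub>F w in at z. norm (J w - J z) \<le> norm (w - z) * (1 / Im w * (1 / Im z * (1 / Im z)))"
      using ev by eventually_elim (use assms norm_kernel_square_integral_diff_le in \<open>auto simp: J_def\<close>)
    show "((\<lambda>w. norm (w - z) * (1 / Im w * (1 / Im z * (1 / Im z)))) \<longlongrightarrow> 0) (at z)"
      by (rule tendsto_eq_intros refl | use assms in simp)+
  qed
  then have "(J \<longlongrightarrow> J z) (at z)" by (simp add: LIM_zero_iff)
  then have lim: "((\<lambda>w. - J w) \<longlongrightarrow> - J z) (at z)" by (rule tendsto_minus)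
  show ?thesis
    unfolding has_field_derivative_iff J_def[symmetric]
  proof (rule Lim_transform_eventually[OF lim])
    show "\<forall>\<^sub>F w in at z. - J w = (cauchy_transform M w - cauchy_transform M z) / (w - z)"
      using ev eventually_neq_at_within[of z z UNIV]
    proof eventually_elim
      case (elim w)
      then show ?case
        using cauchy_transform_diff[of w z] assms by (simp add: J_def field_simps)
    qed
  qed
qed

lemma cauchy_transform_holomorphic: "cauchy_transform M holomorphic_on {z. Im z > 0}"
  using cauchy_transform_has_field_derivative
  by (auto simp: holomorphic_on_open open_halfspace_Im_gt)

lemma Im_cauchy_kernel:
  assumes "Im z > 0"
  shows "Im (1 / (z - complex_of_real x)) = - Im z * (norm (1 / (z - complex_of_real x)))\<^sup>2"
proof -
  have "Im (1 / (z - complex_of_real x)) = - Im z / (norm (z - complex_of_real x))\<^sup>2"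
    by (simp add: Im_divide cmod_power2)
  then show ?thesis by (simp add: norm_divide power_divide)
qed

text \<open>Integrating \<open>Im_cauchy_kernel\<close> gives \<open>- Im z\<close> times the second
  moment of the modulus of the kernel. Nonnegativity of the variance of that modulus, a form of
  Cauchy-Schwarz, bounds the second moment below by the squared norm of the transform.\<close>

lemma Im_cauchy_transform_le:
  assumes "Im z > 0"
  shows "Im (cauchy_transform M z) \<le> - Im z * (norm (cauchy_transform M z))\<^sup>2"
proof -
  let ?k = "\<lambda>x. 1 / (z - complex_of_real x)"
  have int2: "integrable M (\<lambda>x. (norm (?k x))\<^sup>2)"
  proof (rule integrable_const_bound[where B = "(1 / Im z)\<^sup>2"])
    show "AE x in M. norm ((norm (?k x))\<^sup>2) \<le> (1 / Im z)\<^sup>2"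
      using norm_cauchy_kernel_le[OF assms] by (auto intro!: power_mono AE_I2 simp del: norm_divide)
  qed simp
  have "(norm (cauchy_transform M z))\<^sup>2 \<le> (LINT x|M. norm (?k x))\<^sup>2"
    unfolding cauchy_transform_def by (intro power_mono integral_norm_bound) simp
  also have "\<dots> \<le> (LINT x|M. (norm (?k x))\<^sup>2)"
  proof -
    have "variance (\<lambda>x. norm (?k x)) = expectation (\<lambda>x. (norm (?k x))\<^sup>2) - (expectation (\<lambda>x. norm (?k x)))\<^sup>2"
      using assms int2 by (intro variance_eq) auto
    moreover have "variance (\<lambda>x. norm (?k x)) \<ge> 0"
      by (rule variance_positive)
    ultimately show ?thesis by simp
  qed
  finally have le: "(norm (cauchy_transform M z))\<^sup>2 \<le> (LINT x|M. (norm (?k x))\<^sup>2)" .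
  have "Im (cauchy_transform M z) = (LINT x|M. Im (?k x))"
    unfolding cauchy_transform_def using assms by (subst integral_Im) auto
  also have "\<dots> = - Im z * (LINT x|M. (norm (?k x))\<^sup>2)"
    unfolding Im_cauchy_kernel[OF assms] by simp
  finally show ?thesis
    using le assms by (simp add: mult_left_mono)
qed

text \<open>Strictness excludes a zero of the transform, which the quadratic bound above would still
  allow. Hence \<open>F_transform\<close> is holomorphic on the whole upper half-plane.\<close>

lemma Im_cauchy_transform_less:
  assumes "Im z > 0"
  shows "Im (cauchy_transform M z) < 0"
proof -
  let ?k = "\<lambda>x. 1 / (z - complex_of_real x)"
  have "(LINT x|M. 0) < (LINT x|M. - Im (?k x))"
  proof (rule integral_less_AE_space)
    show "emeasure M (space M) \<noteq> 0" using emeasure_space_1 by simp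
    have "- Im (?k x) > 0" for x
      using assms minus_of_real_neq_0[OF assms, of x] unfolding Im_cauchy_kernel[OF assms] by simp
    then show "AE x in M. 0 < - Im (?k x)" by simp
  qed (use assms in \<open>auto intro!: integrable_Im\<close>)
  moreover have "Im (cauchy_transform M z) = (LINT x|M. Im (?k x))"
    unfolding cauchy_transform_def using assms by (subst integral_Im) auto
  ultimately show ?thesis by simp
qed

lemma cauchy_transform_neq_0: "Im z > 0 \<Longrightarrow> cauchy_transform M z \<noteq> 0"
  using Im_cauchy_transform_less[of z] by auto

lemma Im_F_transform_ge:
  assumes "Im z > 0"
  shows "Im (F_transform M z) \<ge> Im z"
proof -
  have "(norm (cauchy_transform M z))\<^sup>2 > 0"
    using cauchy_transform_neq_0[OF assms] by simp
  moreover have "Im (F_transform M z) = - Im (cauchy_transform M z) / (norm (cauchy_transform M z))\<^sup>2"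
    by (simp add: F_transform_def Im_divide cmod_power2)
  moreover have "Im z * (norm (cauchy_transform M z))\<^sup>2 \<le> - Im (cauchy_transform M z)"
    using Im_cauchy_transform_le[OF assms] by simp
  ultimately show ?thesis by (metis pos_le_divide_eq)
qed

lemma F_transform_holomorphic: "F_transform M holomorphic_on {z. Im z > 0}"
  unfolding F_transform_def[abs_def]
  by (intro holomorphic_intros cauchy_transform_holomorphic) (auto dest: cauchy_transform_neq_0)

end

subsection \<open>Inverses on truncated cones\<close>

lemma trunc_cone_mono:
  assumes "l' \<le> l" "M \<le> M'"
  shows "trunc_cone l' M' \<subseteq> trunc_cone l M"
proof
  fix z assume z: "z \<in> trunc_cone l' M'"
  then have "l' * Im z \<le> l * Im z"
    using assms by (intro mult_right_mono) (auto simp: trunc_cone_def)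
  then show "z \<in> trunc_cone l M"
    using z assms unfolding trunc_cone_def mem_Collect_eq by linarith
qed

lemma open_trunc_cone: "open (trunc_cone l M)"
  unfolding trunc_cone_def by (intro open_Collect_conj open_Collect_less continuous_intros)

lemma Im_pos_trunc_cone: "z \<in> trunc_cone l M \<Longrightarrow> Im z > 0"
  by (simp add: trunc_cone_def)

lemma ii_in_trunc_cone: "l > 0 \<Longrightarrow> y > 0 \<Longrightarrow> y > M \<Longrightarrow> \<i> * complex_of_real y \<in> trunc_cone l M"
  by (simp add: trunc_cone_def)

lemma trunc_cone_nonempty: "l > 0 \<Longrightarrow> trunc_cone l M \<noteq> {}"
  using ii_in_trunc_cone[of l "max 1 (M + 1)" M] by fastforce

lemma norm_le_trunc_cone:
  assumes "z \<in> trunc_cone l M"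
  shows "norm z \<le> (1 + l) * Im z"
  using cmod_le[of z] assms by (auto simp: trunc_cone_def algebra_simps)

text \<open>The condition on \<open>c\<close> forces \<open>c \<le> 1/2\<close>, so a point of the
  disc keeps at least half the height of \<open>w\<close>. It also lets the extra slope
  \<open>1\<close> absorb the horizontal and vertical deviations together.\<close>

lemma cball_subset_trunc_cone:
  assumes "0 < c" "c * (2 * (l + 2)) \<le> 1" "l > 0" "M \<ge> 0" "w \<in> trunc_cone l M"
  shows "cball w (c * Im w) \<subseteq> trunc_cone (l + 1) (M / 2)"
proof
  fix z assume "z \<in> cball w (c * Im w)"
  then have "norm (z - w) \<le> c * Im w"
    by (simp add: dist_norm norm_minus_commute)
  then have re: "\<bar>Re z - Re w\<bar> \<le> c * Im w" and im: "\<bar>Im z - Im w\<bar> \<le> c * Im w"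
    using abs_Re_le_cmod[of "z - w"] abs_Im_le_cmod[of "z - w"] by auto
  have w: "Im w > 0" "Im w > M" "\<bar>Re w\<bar> < l * Im w"
    using assms by (auto simp: trunc_cone_def)
  have c2: "c \<le> 1/2"
  proof -
    have "c * 2 \<le> c * (2 * (l + 2))" using assms by simp
    then show ?thesis using assms(2) by simp
  qed
  have "c * Im w \<le> 1/2 * Im w" using c2 w by (intro mult_right_mono) auto
  then have imz: "Im z \<ge> Im w / 2" "Im z > 0" using im w by linarith+
  have "(l + 1) * (c * Im w) + c * Im w < Im w"
  proof -
    have "c * (2 * (l + 2)) * Im w \<le> 1 * Im w" using assms w by (intro mult_right_mono) auto
    then show ?thesis using w by (simp add: algebra_simps)
  qed
  moreover have "(l + 1) * Im z \<ge> (l + 1) * (Im w - c * Im w)"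
    using im assms by (intro mult_left_mono) auto
  ultimately have "\<bar>Re z\<bar> < (l + 1) * Im z"
    using re w by (simp add: algebra_simps)
  then show "z \<in> trunc_cone (l + 1) (M / 2)"
    using imz w by (auto simp: trunc_cone_def)
qed

section \<open>Behaviour of \<open>F_transform\<close> at infinity in a cone\<close>

context real_distribution
begin

text \<open>Dominated convergence with the constant bound \<open>C\<close>. The cut-off stands in
  for a first moment, which the distribution may fail to have.\<close>

lemma expectation_min_tendsto_0:
  assumes "C \<ge> 0"
  shows "((\<lambda>y. LINT x|M. min C (\<bar>x\<bar> / y)) \<longlongrightarrow> 0) at_top"
proof -
  have "((\<lambda>y. LINT x|M. min C (\<bar>x\<bar> / y)) \<longlongrightarrow> (LINT x|M. 0)) at_top"
  proof (rule integral_dominated_convergence_at_top[where w = "\<lambda>_. C"])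
    have "((\<lambda>y. min C (\<bar>x\<bar> / y)) \<longlongrightarrow> 0) at_top" for x
    proof -
      have "((\<lambda>y. min C (\<bar>x\<bar> / y)) \<longlongrightarrow> min C 0) at_top"
        by (intro tendsto_min tendsto_const) real_asymp
      then show ?thesis using assms by simp
    qed
    then show "AE x in M. ((\<lambda>y. min C (\<bar>x\<bar> / y)) \<longlongrightarrow> 0) at_top" by simp
    show "\<forall>\<^sub>F y in at_top. AE x in M. norm (min C (\<bar>x\<bar> / y)) \<le> C"
      using eventually_gt_at_top[of 0] by eventually_elim (use assms in auto)
  qed auto
  then show ?thesis by simp
qed

lemma expectation_min_small:
  assumes "C \<ge> 0" "\<epsilon> > 0"
  obtains K where "K > 0" "\<And>y. y > K \<Longrightarrow> (LINT x|M. min C (\<bar>x\<bar> / y)) < \<epsilon>"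
proof -
  have "\<forall>\<^sub>F y in at_top. (LINT x|M. min C (\<bar>x\<bar> / y)) < \<epsilon>"
    using order_tendstoD(2)[OF expectation_min_tendsto_0[OF assms(1)] assms(2)] .
  then obtain N where N: "\<And>y. y \<ge> N \<Longrightarrow> (LINT x|M. min C (\<bar>x\<bar> / y)) < \<epsilon>"
    by (auto simp: eventually_at_top_linorder)
  show ?thesis
    by (rule that[of "max 1 N"]) (auto intro!: N)
qed

text \<open>In a cone \<open>norm z\<close> is at most a multiple of \<open>Im z\<close>, so
  \<open>z / (z - x)\<close> is bounded uniformly in \<open>x\<close>. Its deviation from
  \<open>1\<close> is \<open>x / (z - x)\<close>, which is bounded and also small for fixed
  \<open>x\<close>, as the truncated expectation requires.\<close>

lemma scaled_kernel_bounds: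
  assumes "z \<in> trunc_cone l K"
  shows "norm (z / (z - complex_of_real x)) \<le> 1 + l"
    and "norm (z / (z - complex_of_real x) - 1) \<le> min (2 + l) (\<bar>x\<bar> / Im z)"
proof -
  have im: "Im z > 0" using assms Im_pos_trunc_cone by blast
  have d: "norm (1 / (z - complex_of_real x)) \<le> 1 / Im z"
    using norm_cauchy_kernel_le[OF im] .
  have "norm z * norm (1 / (z - complex_of_real x)) \<le> ((1 + l) * Im z) * (1 / Im z)"
    using norm_le_trunc_cone[OF assms] d im
    by (intro mult_mono) (auto intro: order_trans[OF norm_ge_zero])
  then show 1: "norm (z / (z - complex_of_real x)) \<le> 1 + l"
    using im by (simp add: norm_divide)
  have 2: "norm (z / (z - complex_of_real x) - 1) \<le> 2 + l"
    using norm_triangle_ineq4[of "z / (z - complex_of_real x)" 1] 1 by simp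
  have "z / (z - complex_of_real x) - 1 = complex_of_real x * (1 / (z - complex_of_real x))"
    using minus_of_real_neq_0[OF im, of x] by (simp add: field_simps)
  also have "norm \<dots> \<le> \<bar>x\<bar> * (1 / Im z)"
    unfolding norm_mult using d by (intro mult_mono) auto
  finally show "norm (z / (z - complex_of_real x) - 1) \<le> min (2 + l) (\<bar>x\<bar> / Im z)"
    using 2 by simp
qed

lemma norm_z_cauchy_transform_minus_1_le:
  assumes "z \<in> trunc_cone l K" "l > 0"
  shows "norm (z * cauchy_transform M z - 1) \<le> (LINT x|M. min (2 + l) (\<bar>x\<bar> / Im z))"
proof -
  have im: "Im z > 0" using assms Im_pos_trunc_cone by blast
  have int: "integrable M (\<lambda>x. z / (z - complex_of_real x))"
    using integrable_mult_right[OF integrable_cauchy_kernel[OF im], of z] by simp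
  have "z * cauchy_transform M z - 1 = (LINT x|M. z / (z - complex_of_real x) - 1)"
    using int unfolding cauchy_transform_def by (simp add: prob_UNIV flip: integral_mult_right_zero)
  also have "norm \<dots> \<le> (LINT x|M. min (2 + l) (\<bar>x\<bar> / Im z))"
  proof (rule order_trans[OF integral_norm_bound], rule integral_mono)
    show "integrable M (\<lambda>x. min (2 + l) (\<bar>x\<bar> / Im z))"
      by (rule integrable_const_bound[where B = "2 + l"]) (use im assms in auto)
  qed (use int scaled_kernel_bounds[OF assms(1)] in auto)
  finally show ?thesis .
qed

lemma z_cauchy_transform_asymp:
  assumes "l > 0" "\<epsilon> > 0"
  obtains K where "K > 0" "\<And>z. z \<in> trunc_cone l K \<Longrightarrow> norm (z * cauchy_transform M z - 1) < \<epsilon>"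
proof -
  obtain K where K: "K > 0" "\<And>y. y > K \<Longrightarrow> (LINT x|M. min (2 + l) (\<bar>x\<bar> / y)) < \<epsilon>"
    using expectation_min_small[of "2 + l" \<epsilon>] assms by auto
  show ?thesis
  proof (rule that[OF K(1)])
    fix z assume z: "z \<in> trunc_cone l K"
    then show "norm (z * cauchy_transform M z - 1) < \<epsilon>"
      using norm_z_cauchy_transform_minus_1_le[OF z assms(1)] K(2)[of "Im z"]
      by (auto simp: trunc_cone_def)
  qed
qed

text \<open>With \<open>q = z * cauchy_transform M z\<close> one has
  \<open>F_transform M z - z = z * ((1 - q) / q)\<close>, and \<open>q\<close> tends to
  \<open>1\<close> in the cone.\<close>

lemma F_transform_asymp:
  assumes "l > 0" "\<epsilon> > 0"
  obtains K where "K > 0" "\<And>z. z \<in> trunc_cone l K \<Longrightarrow> norm (F_transform M z - z) \<le> \<epsilon> * norm z"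
proof -
  \<comment> \<open>The cap \<open>1/2\<close> keeps \<open>norm q \<ge> 1/2\<close>; dividing by
    \<open>q\<close> then costs a factor \<open>2\<close>, which \<open>\<epsilon> / 2\<close>
    absorbs.\<close>
  define \<delta> where "\<delta> = min (1/2) (\<epsilon> / 2)"
  have \<delta>: "\<delta> > 0" "\<delta> \<le> 1/2" "2 * \<delta> \<le> \<epsilon>" using assms by (auto simp: \<delta>_def)
  obtain K where K: "K > 0" "\<And>z. z \<in> trunc_cone l K \<Longrightarrow> norm (z * cauchy_transform M z - 1) < \<delta>"
    using z_cauchy_transform_asymp[OF assms(1) \<delta>(1)] by blast
  show ?thesis
  proof (rule that[OF K(1)])
    fix z assume z: "z \<in> trunc_cone l K"
    define q where "q = z * cauchy_transform M z"
    have im: "Im z > 0" using z Im_pos_trunc_cone by blast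
    have q: "norm (q - 1) < \<delta>" using K(2)[OF z] by (simp add: q_def)
    have nq: "norm q \<ge> 1/2" using q \<delta>(2) norm_triangle_ineq2[of 1 "1 - q"]
      by (simp add: norm_minus_commute)
    then have "q \<noteq> 0" by auto
    have "F_transform M z - z = z * ((1 - q) / q)"
    proof -
      have "z \<noteq> 0" using im by auto
      then have "F_transform M z = z / q" by (simp add: F_transform_def q_def)
      then show ?thesis using \<open>q \<noteq> 0\<close> by (simp add: field_simps)
    qed
    also have "norm \<dots> = norm z * (norm (1 - q) / norm q)"
      by (simp add: norm_mult norm_divide)
    also have "\<dots> \<le> norm z * (\<delta> / (1/2))"
      using q nq \<delta> by (intro mult_left_mono frac_le) (auto simp: norm_minus_commute)
    also have "\<dots> \<le> \<epsilon> * norm z"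
      using \<delta>(3) mult_right_mono[of "2 * \<delta>" \<epsilon> "norm z"] by (simp add: algebra_simps)
    finally show "norm (F_transform M z - z) \<le> \<epsilon> * norm z" .
  qed
qed

lemma norm_mult_minus_1_le:
  fixes a b :: complex
  shows "norm (a * b - 1) \<le> norm b * norm (a - 1) + norm (b - 1)"
proof -
  have "a * b - 1 = b * (a - 1) + (b - 1)" by (simp add: algebra_simps)
  then show ?thesis by (metis norm_triangle_ineq norm_mult)
qed

text \<open>For \<open>z \<noteq> w\<close> the quotient \<open>z w (G z - G w) / (w - z)\<close> is an average of
  \<open>z w / ((z - x) (w - x))\<close>, which tends to \<open>1\<close> in the cone.\<close>

lemma F_transform_inj_on_trunc_cone:
  assumes "l > 0"
  obtains K where "K > 0" "inj_on (F_transform M) (trunc_cone l K)"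
proof -
  \<comment> \<open>The final bound is \<open>(1 + l) * \<epsilon> + \<epsilon> = 1/2\<close>, which
    contradicts a norm equal to \<open>1\<close>.\<close>
  define \<epsilon> where "\<epsilon> = 1 / (2 * (2 + l))"
  have \<epsilon>: "\<epsilon> > 0" "(2 + l) * \<epsilon> = 1/2" using assms by (auto simp: \<epsilon>_def divide_simps)
  obtain K where K: "K > 0" "\<And>y. y > K \<Longrightarrow> (LINT x|M. min (2 + l) (\<bar>x\<bar> / y)) < \<epsilon>"
    using expectation_min_small[of "2 + l" \<epsilon>] assms \<epsilon> by auto
  have "inj_on (F_transform M) (trunc_cone l K)"
  proof (rule inj_onI, rule ccontr)
    fix z w assume z: "z \<in> trunc_cone l K" and w: "w \<in> trunc_cone l K"
      and eq: "F_transform M z = F_transform M w" and ne: "z \<noteq> w"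
    have im: "Im z > 0" "Im w > 0" "Im z > K" "Im w > K" using z w by (auto simp: trunc_cone_def)
    have "cauchy_transform M z = cauchy_transform M w"
      using eq by (simp add: F_transform_def)
    then have 0: "(LINT x|M. 1 / ((z - complex_of_real x) * (w - complex_of_real x))) = 0"
      using cauchy_transform_diff[OF im(1,2)] ne by simp
    let ?a = "\<lambda>x. z / (z - complex_of_real x)" and ?b = "\<lambda>x. w / (w - complex_of_real x)"
    have ab: "?a x * ?b x = z * w * (1 / ((z - complex_of_real x) * (w - complex_of_real x)))" for x
      by simp
    have int: "integrable M (\<lambda>x. ?a x * ?b x)"
      unfolding ab by (intro integrable_mult_right integrable_cauchy_kernel_mult im)
    have mint: "integrable M (\<lambda>x. min (2 + l) (\<bar>x\<bar> / Im v))" if "Im v > 0" for v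
      by (rule integrable_const_bound[where B = "2 + l"]) (use that assms in auto)
    have "(LINT x|M. ?a x * ?b x) = 0"
      unfolding ab integral_mult_right_zero 0 by simp
    then have "1 = norm (LINT x|M. ?a x * ?b x - 1)"
      using int by (simp add: prob_UNIV)
    also have "\<dots> \<le> (LINT x|M. (1 + l) * min (2 + l) (\<bar>x\<bar> / Im z) + min (2 + l) (\<bar>x\<bar> / Im w))"
    proof (rule order_trans[OF integral_norm_bound], rule integral_mono)
      fix x
      have "norm (?a x * ?b x - 1) \<le> norm (?b x) * norm (?a x - 1) + norm (?b x - 1)"
        by (rule norm_mult_minus_1_le)
      also have "\<dots> \<le> (1 + l) * min (2 + l) (\<bar>x\<bar> / Im z) + min (2 + l) (\<bar>x\<bar> / Im w)"
        using assms by (intro add_mono mult_mono scaled_kernel_bounds[OF z] scaled_kernel_bounds[OF w]) auto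
      finally show "norm (?a x * ?b x - 1) \<le> \<dots>" .
    qed (use int mint im in auto)
    also have "\<dots> = (1 + l) * (LINT x|M. min (2 + l) (\<bar>x\<bar> / Im z)) + (LINT x|M. min (2 + l) (\<bar>x\<bar> / Im w))"
      using mint im by simp
    also have "\<dots> \<le> (1 + l) * \<epsilon> + \<epsilon>"
      using K(2)[OF im(3)] K(2)[OF im(4)] assms by (intro add_mono mult_left_mono) auto
    finally show False using \<epsilon>(2) by (simp add: algebra_simps)
  qed
  then show ?thesis using that K(1) by blast
qed

text \<open>On the disc \<open>F_transform M\<close> is a small perturbation of the identity, so
  \<open>y \<mapsto> w + (y - F_transform M y)\<close> maps the disc into itself and Brouwer's
  theorem supplies a preimage of \<open>w\<close>. The radius may be any small proportion of
  \<open>Im w\<close>, which later gives the normalization of the inverse at infinity.\<close>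

lemma F_transform_surj:
  assumes "0 < c" "c * (2 * (l + 2)) \<le> 1" "l > 0"
  obtains K where "K > 0"
    "\<And>w. w \<in> trunc_cone l K \<Longrightarrow> \<exists>z\<in>cball w (c * Im w). F_transform M z = w"
proof -
  have c2: "c \<le> 1/2"
  proof -
    have "c * 2 \<le> c * (2 * (l + 2))" using assms by simp
    then show ?thesis using assms(2) by simp
  qed
  \<comment> \<open>On the disc \<open>norm y \<le> (l + 2) * (2 * Im w)\<close>, so this choice
    makes the error \<open>\<epsilon> * norm y\<close> at most the radius
    \<open>c * Im w\<close>.\<close>
  define \<epsilon> where "\<epsilon> = c / (2 * (l + 2))"
  have \<epsilon>: "\<epsilon> > 0" "\<epsilon> * (l + 2) * 2 = c" using assms by (auto simp: \<epsilon>_def divide_simps)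
  obtain K where K: "K > 0" "\<And>z. z \<in> trunc_cone (l + 1) K \<Longrightarrow> norm (F_transform M z - z) \<le> \<epsilon> * norm z"
    using F_transform_asymp[of "l + 1" \<epsilon>] assms \<epsilon>(1) by auto
  \<comment> \<open>The height is doubled because the disc around \<open>w\<close> may reach down to
    half the height of \<open>w\<close>.\<close>
  show ?thesis
  proof (rule that[of "2 * K"])
    fix w assume w: "w \<in> trunc_cone l (2 * K)"
    have imw: "Im w > 0" using w Im_pos_trunc_cone by blast
    have sub: "cball w (c * Im w) \<subseteq> trunc_cone (l + 1) K"
      using cball_subset_trunc_cone[OF assms _ w] K(1) by simp
    show "\<exists>z\<in>cball w (c * Im w). F_transform M z = w"
    proof (rule brouwer_surjective_cball[where S = "{w}"])
      show "continuous_on (cball w (c * Im w)) (F_transform M)"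
        using sub Im_pos_trunc_cone
        by (intro continuous_on_subset[OF holomorphic_on_imp_continuous_on[OF F_transform_holomorphic]]) blast
      fix x y assume x: "x \<in> {w}" and y: "y \<in> cball w (c * Im w)"
      have yc: "y \<in> trunc_cone (l + 1) K" using sub y by blast
      have "\<bar>Im y - Im w\<bar> \<le> c * Im w"
        using y abs_Im_le_cmod[of "y - w"] by (simp add: dist_norm norm_minus_commute)
      moreover have "c * Im w \<le> 1/2 * Im w" using c2 imw by (intro mult_right_mono) auto
      ultimately have imy: "Im y \<le> 2 * Im w" by linarith
      have "norm (F_transform M y - y) \<le> \<epsilon> * norm y" using K(2)[OF yc] .
      also have "\<dots> \<le> \<epsilon> * ((l + 2) * (2 * Im w))"
      proof (rule mult_left_mono)
        have "(1 + (l + 1)) * Im y \<le> (1 + (l + 1)) * (2 * Im w)"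
          using imy assms by (intro mult_left_mono) auto
        then show "norm y \<le> (l + 2) * (2 * Im w)"
          using norm_le_trunc_cone[OF yc] by (simp add: add.commute)
      qed (use \<epsilon> in auto)
      also have "\<dots> = (\<epsilon> * (l + 2) * 2) * Im w" by (simp add: algebra_simps)
      also have "\<dots> = c * Im w" by (simp only: \<epsilon>(2))
      finally show "x + (y - F_transform M y) \<in> cball w (c * Im w)"
        using x by (simp add: dist_norm norm_minus_commute)
    qed (use assms imw in auto)
  qed (use K in auto)
qed

text \<open>Injectivity on a wider cone provides a holomorphic inverse \<open>H\<close> on its
  image, and surjectivity with nearby preimages shows that the image contains the narrower cone. By
  injectivity a closer preimage, found for a smaller \<open>c\<close>, is the same point
  \<open>H w\<close>; hence \<open>H w / w\<close> tends to \<open>1\<close>.\<close>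

lemma F_inverse_exists:
  assumes l: "l > 0"
  obtains K H where "K > 0" "is_F_inverse M l K H"
proof -
  define c0 where "c0 = 1 / (2 * (l + 2))"
  have c0: "c0 > 0" "c0 * (2 * (l + 2)) = 1" using l by (auto simp: c0_def)
  obtain K1 where K1: "K1 > 0" "inj_on (F_transform M) (trunc_cone (l + 1) K1)"
    using F_transform_inj_on_trunc_cone[of "l + 1"] l by auto
  obtain K2 where K2: "K2 > 0"
    "\<And>w. w \<in> trunc_cone l K2 \<Longrightarrow> \<exists>z\<in>cball w (c0 * Im w). F_transform M z = w"
    using F_transform_surj[of c0 l] c0 l by auto
  have hol: "F_transform M holomorphic_on trunc_cone (l + 1) K1"
    using F_transform_holomorphic by (rule holomorphic_on_subset) (auto simp: trunc_cone_def)
  obtain H where H: "H holomorphic_on (F_transform M ` trunc_cone (l + 1) K1)"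
    "\<And>z. z \<in> trunc_cone (l + 1) K1 \<Longrightarrow> H (F_transform M z) = z"
    using holomorphic_has_inverse[OF hol open_trunc_cone K1(2)] by metis
  define K where "K = max K2 (2 * K1)"
  have K: "K > 0" "K \<ge> K2" "K / 2 \<ge> K1" using K2 by (auto simp: K_def)
  have near: "F_transform M (H w) = w \<and> H w \<in> trunc_cone (l + 1) K1 \<and> norm (H w - w) \<le> c * Im w"
    if w: "w \<in> trunc_cone l K" and c: "0 < c" "c \<le> c0"
      and z: "z \<in> cball w (c * Im w)" "F_transform M z = w" for w c z
  proof -
    have c': "c * (2 * (l + 2)) \<le> 1"
      using c c0 mult_right_mono[of c c0 "2 * (l + 2)"] l by simp
    have "cball w (c * Im w) \<subseteq> trunc_cone (l + 1) K1"
      using cball_subset_trunc_cone[OF c(1) c' l _ w] K trunc_cone_mono[of "l + 1" "l + 1" K1 "K / 2"] by auto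
    then have zc: "z \<in> trunc_cone (l + 1) K1" using z by blast
    then have "H w = z" using H(2)[OF zc] z by simp
    then show ?thesis using z zc by (simp add: dist_norm norm_minus_commute)
  qed
  have sub: "trunc_cone l K \<subseteq> trunc_cone l K2" using K by (intro trunc_cone_mono) auto
  have ex: "F_transform M (H w) = w \<and> H w \<in> trunc_cone (l + 1) K1" if "w \<in> trunc_cone l K" for w
    using K2(2)[of w] near[OF that c0(1) order_refl] that sub by blast
  have "is_F_inverse M l K H"
    unfolding is_F_inverse_def
  proof (intro conjI ballI)
    show "H holomorphic_on trunc_cone l K"
      using ex by (intro holomorphic_on_subset[OF H(1)]) (auto intro!: image_eqI[where x = "H _"])
    show "Im (H z) > 0" if "z \<in> trunc_cone l K" for z
      using ex[OF that] Im_pos_trunc_cone by blast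
    show "F_transform M (H z) = z" if "z \<in> trunc_cone l K" for z
      using ex[OF that] by blast
    show "((\<lambda>z. H z / z) \<longlongrightarrow> 1) (inf at_infinity (principal (trunc_cone l K)))"
    proof (rule tendstoI)
      fix e :: real assume e: "e > 0"
      define c where "c = min c0 (e / 2)"
      have c: "c > 0" "c \<le> c0" "c < e" using c0 e by (auto simp: c_def)
      have c': "c * (2 * (l + 2)) \<le> 1"
        using c c0 mult_right_mono[of c c0 "2 * (l + 2)"] l by simp
      obtain K3 where K3: "K3 > 0"
        "\<And>w. w \<in> trunc_cone l K3 \<Longrightarrow> \<exists>z\<in>cball w (c * Im w). F_transform M z = w"
        using F_transform_surj[OF c(1) c' l] by metis
      have "dist (H w / w) 1 < e" if b: "norm w \<ge> (1 + l) * (K3 + 1)" and w: "w \<in> trunc_cone l K" for w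
      proof -
        have imw: "Im w > 0" using w Im_pos_trunc_cone by blast
        then have w0: "w \<noteq> 0" by auto
        have "(1 + l) * (K3 + 1) \<le> (1 + l) * Im w" using b norm_le_trunc_cone[OF w] by simp
        then have "K3 + 1 \<le> Im w" using l by (simp only: mult_le_cancel_left_pos)
        then have "w \<in> trunc_cone l K3" using w by (auto simp: trunc_cone_def)
        then have "norm (H w - w) \<le> c * Im w"
          using K3(2)[of w] near[OF w c(1,2)] by blast
        also have "\<dots> \<le> c * norm w" using c abs_Im_le_cmod[of w] by (intro mult_left_mono) auto
        also have "\<dots> < e * norm w" using c w0 by simp
        finally have "norm (H w - w) / norm w < e" using w0 by (simp add: divide_simps)
        moreover have "H w / w - 1 = (H w - w) / w" using w0 by (simp add: divide_simps)
        ultimately show ?thesis by (simp add: dist_norm norm_divide)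
      qed
      then show "\<forall>\<^sub>F w in inf at_infinity (principal (trunc_cone l K)). dist (H w / w) 1 < e"
        unfolding eventually_inf_principal eventually_at_infinity by blast
    qed
  qed
  then show ?thesis using that K(1) by blast
qed

end

section \<open>Localization and uniqueness of the inverse\<close>

lemma is_F_inverse_subset:
  assumes "is_F_inverse \<mu> l M H" "trunc_cone l' M' \<subseteq> trunc_cone l M"
  shows "is_F_inverse \<mu> l' M' H"
proof -
  have "inf at_infinity (principal (trunc_cone l' M')) \<le> inf at_infinity (principal (trunc_cone l M))"
    using assms(2) by (intro inf_mono) auto
  then show ?thesis
    using assms unfolding is_F_inverse_def
    by (blast intro: holomorphic_on_subset tendsto_mono)
qed

text \<open>Since \<open>H z / z\<close> tends to \<open>1\<close>, far up the value
  \<open>H z\<close> lies in the disc of radius \<open>c * Im z\<close> around \<open>z\<close>,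
  hence in a wider cone of any prescribed height \<open>K\<close>.\<close>

lemma F_inverse_in_trunc_cone:
  assumes H: "is_F_inverse \<mu> l M H" and l: "l > 0"
  obtains M' where "M' > 0" "M' \<ge> M" "\<And>z. z \<in> trunc_cone l M' \<Longrightarrow> H z \<in> trunc_cone (l + 1) K"
proof -
  define c where "c = 1 / (2 * (l + 2))"
  have c: "c > 0" "c * (2 * (l + 2)) = 1" using l by (auto simp: c_def)
  have "((\<lambda>z. H z / z) \<longlongrightarrow> 1) (inf at_infinity (principal (trunc_cone l M)))"
    using H by (simp add: is_F_inverse_def)
  from tendstoD[OF this, of "c / (1 + l)"] obtain b where
    b: "\<And>z. norm z \<ge> b \<Longrightarrow> z \<in> trunc_cone l M \<Longrightarrow> dist (H z / z) 1 < c / (1 + l)"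
    using c l unfolding eventually_inf_principal eventually_at_infinity by auto
  \<comment> \<open>Height above \<open>b\<close> activates the limit estimate, since
    \<open>norm z \<ge> Im z\<close>; the entry \<open>2 * K\<close> compensates for the halved
    height in \<open>cball_subset_trunc_cone\<close>.\<close>
  define M' where "M' = Max {1, M, b, 2 * K}"
  have M': "M' > 0" "M' \<ge> M" "M' \<ge> b" "M' / 2 \<ge> K" by (auto simp: M'_def)
  show ?thesis
  proof (rule that[OF M'(1,2)])
    fix z assume z: "z \<in> trunc_cone l M'"
    have im: "Im z > 0" "Im z > M'" using z by (auto simp: trunc_cone_def)
    then have z0: "z \<noteq> 0" by auto
    have zM: "z \<in> trunc_cone l M" using z M' trunc_cone_mono[of l l M M'] by auto
    have "norm z \<ge> b" using abs_Im_le_cmod[of z] im M' by linarith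
    then have "norm (H z / z - 1) < c / (1 + l)" using b zM by (simp add: dist_norm)
    moreover have "H z / z - 1 = (H z - z) / z" using z0 by (simp add: divide_simps)
    ultimately have "norm (H z - z) < c / (1 + l) * norm z"
      using z0 by (simp add: norm_divide pos_divide_less_eq)
    also have "\<dots> \<le> c / (1 + l) * ((1 + l) * Im z)"
      using norm_le_trunc_cone[OF z] c l by (intro mult_left_mono) auto
    also have "\<dots> = c * Im z" using l by simp
    finally have "H z \<in> cball z (c * Im z)" by (simp add: dist_norm norm_minus_commute)
    then show "H z \<in> trunc_cone (l + 1) K"
      using cball_subset_trunc_cone[of c l M' z] c l M' z trunc_cone_mono[of "l + 1" "l + 1" K "M' / 2"] by auto
  qed
qed

text \<open>Both inverses eventually take values in a cone on which \<open>F_transform\<close> is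
  injective, and there they solve the same equation. This is what the normalization at infinity is
  for.\<close>

lemma F_inverse_unique:
  assumes "real_distribution \<mu>" "is_F_inverse \<mu> l M1 H1" "is_F_inverse \<mu> l M2 H2" "l > 0"
  obtains M where "M > 0" "M \<ge> M1" "M \<ge> M2" "\<And>z. z \<in> trunc_cone l M \<Longrightarrow> H1 z = H2 z"
proof -
  interpret real_distribution \<mu> by fact
  obtain K where K: "K > 0" "inj_on (F_transform \<mu>) (trunc_cone (l + 1) K)"
    using F_transform_inj_on_trunc_cone[of "l + 1"] assms by auto
  obtain N1 where N1: "N1 > 0" "N1 \<ge> M1" "\<And>z. z \<in> trunc_cone l N1 \<Longrightarrow> H1 z \<in> trunc_cone (l + 1) K"
    using F_inverse_in_trunc_cone[OF assms(2,4)] by metis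
  obtain N2 where N2: "N2 > 0" "N2 \<ge> M2" "\<And>z. z \<in> trunc_cone l N2 \<Longrightarrow> H2 z \<in> trunc_cone (l + 1) K"
    using F_inverse_in_trunc_cone[OF assms(3,4)] by metis
  show ?thesis
  proof (rule that[of "max N1 N2"])
    fix z assume z: "z \<in> trunc_cone l (max N1 N2)"
    then have zs: "z \<in> trunc_cone l N1" "z \<in> trunc_cone l N2" by (auto simp: trunc_cone_def)
    then have "z \<in> trunc_cone l M1" "z \<in> trunc_cone l M2" using N1 N2 by (auto simp: trunc_cone_def)
    then have "F_transform \<mu> (H1 z) = F_transform \<mu> (H2 z)"
      using assms(2,3) by (simp add: is_F_inverse_def)
    then show "H1 z = H2 z" using K(2) N1(3) N2(3) zs by (auto dest: inj_onD)
  qed (use N1 N2 in auto)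
qed

text \<open>On the image of the cone under \<open>H\<^sub>\<rho>\<close> the function \<open>(z + (s - 1) F\<^sub>\<rho> z) / s\<close> is
  \<open>H\<^sub>\<nu> \<circ> F\<^sub>\<rho>\<close>; the identity then propagates by analytic continuation.\<close>

lemma free_power_subordination:
  assumes \<nu>: "real_distribution \<nu>" and \<rho>: "real_distribution \<rho>" and s: "s \<ge> 1" and l: "l > 0"
    and H\<nu>: "is_F_inverse \<nu> l M H\<nu>" and H\<rho>: "is_F_inverse \<rho> l M H\<rho>"
    and eq: "\<And>z. z \<in> trunc_cone l M \<Longrightarrow> H\<rho> z - z = complex_of_real s * (H\<nu> z - z)"
    and z: "Im z > 0"
  shows "F_transform \<nu> ((z + (complex_of_real s - 1) * F_transform \<rho> z) / complex_of_real s) = F_transform \<rho> z"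
proof -
  interpret \<nu>: real_distribution \<nu> by fact
  interpret \<rho>: real_distribution \<rho> by fact
  define \<omega> where "\<omega> z = (z + (complex_of_real s - 1) * F_transform \<rho> z) / complex_of_real s" for z
  have im\<omega>: "Im (\<omega> z) > 0" if "Im z > 0" for z
  proof -
    have eq: "complex_of_real s - 1 = complex_of_real (s - 1)" by simp
    have "Im (\<omega> z) = (Im z + (s - 1) * Im (F_transform \<rho> z)) / s"
      unfolding \<omega>_def eq Im_divide_of_real by simp
    then show ?thesis
      using that \<rho>.Im_F_transform_ge[OF that] s by (auto intro!: divide_pos_pos add_pos_nonneg)
  qed
  have hol\<omega>: "\<omega> holomorphic_on {z. Im z > 0}"
    unfolding \<omega>_def using s by (intro holomorphic_intros \<rho>.F_transform_holomorphic) auto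
  \<comment> \<open>\<open>F_transform \<rho>\<close> is a left inverse of \<open>H\<rho>\<close>,
    so the image of the cone under \<open>H\<rho>\<close> is open by the open mapping theorem and
    can serve as the starting set of the continuation.\<close>
  have "inj_on H\<rho> (trunc_cone l M)"
    using H\<rho> unfolding is_F_inverse_def
    by (intro inj_on_inverseI[where g = "F_transform \<rho>"]) auto
  then have op: "open (H\<rho> ` trunc_cone l M)"
    using H\<rho> open_mapping_thm3[OF _ open_trunc_cone] by (auto simp: is_F_inverse_def)
  have "(F_transform \<nu> \<circ> \<omega>) z = F_transform \<rho> z"
  proof (rule analytic_continuation_open[where f = "F_transform \<nu> \<circ> \<omega>"])
    show "open (H\<rho> ` trunc_cone l M)" by fact
    show "open {z. Im z > 0}" by (rule open_halfspace_Im_gt)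
    show "connected {z. Im z > 0}" by (intro convex_connected convex_halfspace_Im_gt)
    show "H\<rho> ` trunc_cone l M \<noteq> {}" using trunc_cone_nonempty[OF l] by blast
    show "H\<rho> ` trunc_cone l M \<subseteq> {z. Im z > 0}" using H\<rho> by (auto simp: is_F_inverse_def)
    show "F_transform \<nu> \<circ> \<omega> holomorphic_on {z. Im z > 0}"
      using im\<omega> by (intro holomorphic_on_compose_gen[OF hol\<omega> \<nu>.F_transform_holomorphic]) auto
    show "F_transform \<rho> holomorphic_on {z. Im z > 0}" by (rule \<rho>.F_transform_holomorphic)
    show "(F_transform \<nu> \<circ> \<omega>) w = F_transform \<rho> w" if "w \<in> H\<rho> ` trunc_cone l M" for w
    proof -
      obtain v where v: "v \<in> trunc_cone l M" "w = H\<rho> v" using \<open>w \<in> _\<close> by blast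
      have F: "F_transform \<rho> w = v" "F_transform \<nu> (H\<nu> v) = v"
        using H\<rho> H\<nu> v by (auto simp: is_F_inverse_def)
      have "w = v + complex_of_real s * (H\<nu> v - v)" using eq[OF v(1)] v(2) by (simp add: algebra_simps)
      then have "\<omega> w = H\<nu> v" using s unfolding \<omega>_def F(1) by (simp add: field_simps)
      then show ?thesis using F by simp
    qed
  qed (use z in auto)
  then show ?thesis by (simp add: \<omega>_def)
qed

subsection \<open>Poisson integrals and Boolean powers\<close>

lemma norm_contour_integral_linepath_le:
  assumes "continuous_on (closed_segment a b) f" "B \<ge> 0" "norm (b - a) \<le> L"
    and "\<And>w. w \<in> closed_segment a b \<Longrightarrow> norm (f w) \<le> B"
  shows "norm (contour_integral (linepath a b) f) \<le> B * L"
  using contour_integral_bound_linepath[OF contour_integrable_continuous_linepath[OF assms(1)] assms(2,4)]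
    mult_left_mono[OF assms(3,2)] by (meson order_trans)

text \<open>Cauchy's formula is applied to \<open>g w * (Im z / pi) / (w - cnj z)\<close> on the
  boundary of a rectangle with base from \<open>-R\<close> to \<open>R\<close> and height
  \<open>R\<close>. The added factor turns the Cauchy kernel on the real axis into the Poisson
  kernel and makes the integrand of order \<open>1 / R^2\<close> on the other three sides, whose
  total length is \<open>4 * R\<close>.\<close>

lemma poisson_half_plane_error:
  assumes d: "d > 0" and hol: "g holomorphic_on {w. Im w > - d}"
    and B: "\<And>w. Im w \<ge> 0 \<Longrightarrow> norm (g w) \<le> B" and z: "Im z > 0" and R: "R > norm z"
  shows "norm (g z - integral {-R..R}
            (\<lambda>x. g (complex_of_real x) * complex_of_real (Im z / (pi * (norm (complex_of_real x - z))\<^sup>2))))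
         \<le> 4 * (B * (Im z / pi) / (R - norm z)\<^sup>2 * R)"
proof -
  \<comment> \<open>The half-plane \<open>Im w > - e\<close> contains the real axis but not the pole
    \<open>cnj z\<close>, and \<open>g\<close> is holomorphic on it.\<close>
  define e where "e = min d (Im z)"
  have e: "e > 0" "e \<le> d" "e \<le> Im z" using d z by (auto simp: e_def)
  define f where "f w = g w * complex_of_real (Im z / pi) / (w - cnj z)" for w
  define k where "k w = f w / (w - z)" for w
  define S where "S = {w. Im w > - e}"
  have R0: "R > 0" using R norm_ge_zero[of z] by linarith
  have B0: "B \<ge> 0" using B[of 0] norm_ge_zero[of "g 0"] by (metis order_trans zero_complex.simps(2) order_refl)
  have cz: "w \<noteq> cnj z" if "Im w > - e" for w using that e by auto
  have holf: "f holomorphic_on S"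
    unfolding f_def S_def using cz e
    by (intro holomorphic_intros holomorphic_on_subset[OF hol]) auto
  have zbox: "z \<in> box (complex_of_real (-R)) (Complex R R)"
    using R z abs_Re_le_cmod[of z] abs_Im_le_cmod[of z] by (auto simp: in_box_complex_iff)
  have sub: "path_image (rectpath (complex_of_real (-R)) (Complex R R)) \<subseteq> S - {z}"
  proof -
    have "path_image (rectpath (complex_of_real (-R)) (Complex R R)) \<subseteq> {w. Im w \<ge> 0} - {z}"
      using zbox R0 by (auto simp: path_image_rectpath in_box_complex_iff)
    then show ?thesis using e by (auto simp: S_def)
  qed
  have "((\<lambda>w. f w / (w - z)) has_contour_integral
      2 * pi * \<i> * winding_number (rectpath (complex_of_real (-R)) (Complex R R)) z * f z)
      (rectpath (complex_of_real (-R)) (Complex R R))"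
  proof (rule Cauchy_integral_formula_convex_simple[OF _ holf _ valid_path_rectpath sub])
    show "convex S" unfolding S_def by (rule convex_halfspace_Im_gt)
    show "z \<in> interior S"
      using interior_open[of S] open_halfspace_Im_gt[of "-e"] z e by (auto simp: S_def)
  qed simp
  moreover have "2 * pi * \<i> * winding_number (rectpath (complex_of_real (-R)) (Complex R R)) z * f z = g z"
  proof -
    have "z - cnj z = 2 * \<i> * complex_of_real (Im z)" by (simp add: complex_eq_iff)
    then have "f z = g z * complex_of_real (Im z / pi) / (2 * \<i> * complex_of_real (Im z))"
      unfolding f_def by (simp only:)
    then show ?thesis
      unfolding winding_number_rectpath[OF zbox] using z by (simp add: field_simps)
  qed
  ultimately have int: "(k has_contour_integral g z) (rectpath (complex_of_real (-R)) (Complex R R))"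
    unfolding k_def by simp
  have contk: "continuous_on (S - {z}) k"
    unfolding k_def
    by (intro continuous_intros continuous_on_subset[OF holomorphic_on_imp_continuous_on[OF holf]]) auto
  define c1 c2 c3 c4 where "c1 = complex_of_real (-R)" and "c2 = complex_of_real R"
    and "c3 = Complex R R" and "c4 = Complex (-R) R"
  have rect: "rectpath (complex_of_real (-R)) (Complex R R) =
      linepath c1 c2 +++ linepath c2 c3 +++ linepath c3 c4 +++ linepath c4 c1"
    by (simp add: rectpath_def Let_def c1_def c2_def c3_def c4_def complex_of_real_def)
  have segs: "closed_segment c1 c2 \<subseteq> S - {z}" "closed_segment c2 c3 \<subseteq> S - {z}"
      "closed_segment c3 c4 \<subseteq> S - {z}" "closed_segment c4 c1 \<subseteq> S - {z}"
    using sub unfolding rect by (auto simp: path_image_join)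
  have ints: "k contour_integrable_on linepath c1 c2" "k contour_integrable_on linepath c2 c3"
      "k contour_integrable_on linepath c3 c4" "k contour_integrable_on linepath c4 c1"
    using segs by (auto intro!: contour_integrable_continuous_linepath continuous_on_subset[OF contk])
  have split: "g z = contour_integral (linepath c1 c2) k + (contour_integral (linepath c2 c3) k +
      (contour_integral (linepath c3 c4) k + contour_integral (linepath c4 c1) k))"
    using contour_integral_unique[OF int] ints unfolding rect
    by (simp add: contour_integral_join contour_integrable_join valid_path_join)
  define C where "C = B * (Im z / pi) / (R - norm z)\<^sup>2"
  have C0: "C \<ge> 0" unfolding C_def using B0 z by simp
  have kb: "norm (k w) \<le> C" if "norm w \<ge> R" "Im w \<ge> 0" for w
  proof -
    have "norm (w - z) \<ge> R - norm z" using norm_triangle_ineq2[of w z] that by linarith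
    moreover have "norm (w - cnj z) \<ge> R - norm z"
      using norm_triangle_ineq2[of w "cnj z"] that by simp
    ultimately have "norm (w - cnj z) * norm (w - z) \<ge> (R - norm z)\<^sup>2"
      unfolding power2_eq_square using R by (intro mult_mono) auto
    moreover have "norm (k w) = norm (g w) * (Im z / pi) / (norm (w - cnj z) * norm (w - z))"
      using z by (simp add: k_def f_def norm_mult norm_divide)
    ultimately show ?thesis
      unfolding C_def using B[OF that(2)] z R B0
      by (auto intro!: frac_le mult_right_mono divide_right_mono zero_less_power)
  qed
  have far: "norm w \<ge> R" "Im w \<ge> 0"
    if "w \<in> closed_segment c2 c3 \<union> closed_segment c3 c4 \<union> closed_segment c4 c1" for w
  proof -
    have "(Re w = R \<or> Re w = - R \<or> Im w = R) \<and> Im w \<ge> 0"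
      using that R0 by (auto simp: c1_def c2_def c3_def c4_def closed_segment_same_Re
          closed_segment_same_Im closed_segment_eq_real_ivl split: if_splits)
    then show "norm w \<ge> R" "Im w \<ge> 0"
      using abs_Re_le_cmod[of w] abs_Im_le_cmod[of w] by auto
  qed
  have b2: "norm (contour_integral (linepath c2 c3) k) \<le> C * R"
    using R0 far segs C0 by (intro norm_contour_integral_linepath_le kb continuous_on_subset[OF contk])
      (auto simp: c2_def c3_def cmod_def)
  have b3: "norm (contour_integral (linepath c3 c4) k) \<le> C * (2 * R)"
    using R0 far segs C0 by (intro norm_contour_integral_linepath_le kb continuous_on_subset[OF contk])
      (auto simp: c3_def c4_def cmod_def real_sqrt_mult)
  have b4: "norm (contour_integral (linepath c4 c1) k) \<le> C * R"
    using R0 far segs C0 by (intro norm_contour_integral_linepath_le kb continuous_on_subset[OF contk])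
      (auto simp: c1_def c4_def cmod_def)
  have kx: "k (complex_of_real x) = g (complex_of_real x) * complex_of_real (Im z / (pi * (norm (complex_of_real x - z))\<^sup>2))" for x
  proof -
    have "complex_of_real x - cnj z = cnj (complex_of_real x - z)" by simp
    then have "(complex_of_real x - cnj z) * (complex_of_real x - z) = complex_of_real ((norm (complex_of_real x - z))\<^sup>2)"
      by (metis complex_norm_square mult.commute of_real_power)
    then show ?thesis unfolding k_def f_def by (simp add: mult.commute mult.left_commute)
  qed
  have "contour_integral (linepath c1 c2) k = integral {-R..R} (\<lambda>x. k (complex_of_real x))"
    using R0 by (subst contour_integral_linepath_Reals_eq) (auto simp: c1_def c2_def)
  then have "g z - integral {-R..R} (\<lambda>x. k (complex_of_real x)) =
      contour_integral (linepath c2 c3) k + (contour_integral (linepath c3 c4) k + contour_integral (linepath c4 c1) k)"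
    using split by simp
  also have "norm \<dots> \<le> C * R + (C * (2 * R) + C * R)"
    using b2 b3 b4 by (intro order_trans[OF norm_triangle_ineq] add_mono) auto
  also have "\<dots> = 4 * (C * R)" by simp
  finally show ?thesis unfolding kx C_def by simp
qed

lemma poisson_half_plane_limit:
  assumes d: "d > 0" and hol: "g holomorphic_on {w. Im w > - d}"
    and B: "\<And>w. Im w \<ge> 0 \<Longrightarrow> norm (g w) \<le> B" and z: "Im z > 0"
  shows "((\<lambda>R. integral {-R..R}
            (\<lambda>x. g (complex_of_real x) * complex_of_real (Im z / (pi * (norm (complex_of_real x - z))\<^sup>2))))
          \<longlongrightarrow> g z) at_top"
proof -
  let ?I = "\<lambda>R. integral {-R..R}
            (\<lambda>x. g (complex_of_real x) * complex_of_real (Im z / (pi * (norm (complex_of_real x - z))\<^sup>2)))"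
  have "((\<lambda>R. g z - ?I R) \<longlongrightarrow> 0) at_top"
  proof (rule Lim_null_comparison)
    show "\<forall>\<^sub>F R in at_top. norm (g z - ?I R) \<le> 4 * (B * (Im z / pi) / (R - norm z)\<^sup>2 * R)"
      using eventually_gt_at_top[of "norm z"]
      by eventually_elim (rule poisson_half_plane_error[OF d hol B z])
    show "((\<lambda>R. 4 * (B * (Im z / pi) / (R - norm z)\<^sup>2 * R)) \<longlongrightarrow> 0) at_top"
    proof -
      have "((\<lambda>R. 4 * (C / (R - b)\<^sup>2 * R)) \<longlongrightarrow> 0) at_top" for C b :: real by real_asymp
      then show ?thesis .
    qed
  qed
  from tendsto_diff[OF tendsto_const[of "g z"] this] show ?thesis by simp
qed

text \<open>The sign condition makes the integrand nonnegative, so monotone convergence upgrades the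
  limit over symmetric intervals to a genuine Lebesgue integral.\<close>

lemma poisson_half_plane_Im:
  assumes d: "d > 0" and hol: "g holomorphic_on {w. Im w > - d}"
    and B: "\<And>w. Im w \<ge> 0 \<Longrightarrow> norm (g w) \<le> B" and z: "Im z > 0"
    and neg: "\<And>x. Im (g (complex_of_real x)) \<le> 0"
  shows "has_bochner_integral lborel
    (\<lambda>x. - Im (g (complex_of_real x)) * (Im z / (pi * (norm (complex_of_real x - z))\<^sup>2))) (- Im (g z))"
proof -
  define P where "P x = Im z / (pi * (norm (complex_of_real x - z))\<^sup>2)" for x
  define q where "q x = - Im (g (complex_of_real x)) * P x" for x
  have P0: "P x \<ge> 0" for x using z by (simp add: P_def)
  have q0: "q x \<ge> 0" for x unfolding q_def using neg[of x] P0[of x] by (simp add: mult_nonpos_nonneg)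
  have nz: "complex_of_real x - z \<noteq> 0" for x using z by (auto simp: complex_eq_iff)
  have contg: "continuous_on UNIV (\<lambda>x. g (complex_of_real x))"
    using d by (intro continuous_on_compose2[OF holomorphic_on_imp_continuous_on[OF hol]] continuous_intros) auto
  have contP: "continuous_on UNIV P"
    unfolding P_def using nz by (intro continuous_intros) auto
  have contq: "continuous_on UNIV q"
    unfolding q_def by (intro continuous_intros contg contP)
  have contgP: "continuous_on UNIV (\<lambda>x. g (complex_of_real x) * complex_of_real (P x))"
    by (intro continuous_intros contg contP)
  have qint: "set_integrable lborel {-R..R} q" for R
    by (intro borel_integrable_atLeastAtMost' continuous_on_subset[OF contq]) auto
  have val: "(LINT x:{-R..R}|lborel. q x) = - Im (integral {-R..R} (\<lambda>x. g (complex_of_real x) * complex_of_real (P x)))" for R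
  proof -
    have "(\<lambda>x. g (complex_of_real x) * complex_of_real (P x)) integrable_on {-R..R}"
      by (intro integrable_continuous_real continuous_on_subset[OF contgP]) auto
    from integral_linear[OF this bounded_linear_Im]
    have "Im (integral {-R..R} (\<lambda>x. g (complex_of_real x) * complex_of_real (P x)))
        = integral {-R..R} (\<lambda>x. - q x)"
      by (simp add: o_def q_def)
    then show ?thesis
      using set_borel_integral_eq_integral(2)[OF qint[of R]] by simp
  qed
  have lim: "((\<lambda>R. LINT x:{-R..R}|lborel. q x) \<longlongrightarrow> - Im (g z)) at_top"
    unfolding val P_def by (intro tendsto_minus tendsto_Im poisson_half_plane_limit[OF d hol B z])
  have "integrable lborel q \<and> integral\<^sup>L lborel q = - Im (g z)"
  proof (intro conjI)
    let ?f = "\<lambda>n::nat. \<lambda>x. indicator {- real n..real n} x *\<^sub>R q x"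
    have int: "integrable lborel (?f n)" for n
      using qint[of "real n"] by (simp add: set_integrable_def)
    have mono: "AE x in lborel. mono (\<lambda>n. ?f n x)"
      using q0 by (intro AE_I2 monoI) (auto simp: indicator_def)
    have pos: "AE x in lborel. 0 \<le> ?f n x" for n
      using q0 by (intro AE_I2) auto
    have lims: "AE x in lborel. (\<lambda>n. ?f n x) \<longlonglongrightarrow> q x"
    proof (rule AE_I2)
      fix x :: real
      have "\<forall>\<^sub>F n in sequentially. ?f n x = q x"
        using eventually_ge_at_top[of "nat \<lceil>\<bar>x\<bar>\<rceil>"] by eventually_elim (auto simp: indicator_def nat_le_iff ceiling_le_iff)
      then show "(\<lambda>n. ?f n x) \<longlonglongrightarrow> q x" by (rule tendsto_eventually)
    qed
    have ilim: "(\<lambda>n. integral\<^sup>L lborel (?f n)) \<longlonglongrightarrow> - Im (g z)"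
      using filterlim_compose[OF lim filterlim_real_sequentially]
      by (simp add: set_lebesgue_integral_def)
    have meas: "q \<in> borel_measurable lborel"
      using borel_measurable_continuous_onI[OF contq] by simp
    show "integrable lborel q"
      by (rule integral_monotone_convergence_nonneg(1)[OF int mono pos lims ilim meas])
    show "integral\<^sup>L lborel q = - Im (g z)"
      by (rule integral_monotone_convergence_nonneg(2)[OF int mono pos lims ilim meas])
  qed
  then show ?thesis
    unfolding q_def P_def by (simp add: has_bochner_integral_iff)
qed

section \<open>Reconstruction of a measure from its Cauchy transform\<close>

lemma holomorphic_Im_0_imp_constant_on:
  assumes "f holomorphic_on S" "open S" "connected S" "\<And>z. z \<in> S \<Longrightarrow> Im (f z) = 0"
  shows "f constant_on S"
proof (rule ccontr)
  assume nc: "\<not> f constant_on S"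
  then have ne: "S \<noteq> {}" by (auto simp: constant_on_def)
  \<comment> \<open>A nonconstant map has an open image, but the real axis contains no disc: moving
    up by \<open>e / 2\<close> leaves it.\<close>
  have op: "open (f ` S)"
    by (rule open_mapping_thm[OF assms(1-3) assms(2) order_refl nc])
  obtain z where z: "z \<in> S" using ne by blast
  obtain e where e: "e > 0" "ball (f z) e \<subseteq> f ` S"
    using op z by (meson imageI open_contains_ball)
  have "f z + \<i> * complex_of_real (e / 2) \<in> ball (f z) e"
    using e(1) by (simp add: dist_norm norm_mult)
  then obtain w where "w \<in> S" "f w = f z + \<i> * complex_of_real (e / 2)" using e(2) by auto
  then show False using assms(4)[of w] assms(4)[OF z] e(1) by simp
qed

lemma divide_add_self_mono:
  fixes a b c :: real
  assumes "0 < a" "a \<le> b" "0 \<le> c"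
  shows "a / (c + a) \<le> b / (c + b)"
proof -
  have "a * (c + b) \<le> b * (c + a)"
    using mult_right_mono[OF assms(2,3)] by (simp add: algebra_simps)
  then show ?thesis
    using assms by (simp add: pos_divide_le_eq pos_le_divide_eq)
qed

text \<open>Stieltjes inversion after a shift: moving up by \<open>e\<close> makes \<open>G\<close>
  bounded and holomorphic across the real axis, so the Poisson formula gives a density
  \<open>p\<close>. Its transform has the same imaginary part as the shifted \<open>G\<close>; the
  difference is then constant, and decay along the imaginary axis makes the constant
  \<open>0\<close>.\<close>

lemma smoothed_cauchy_transform:
  assumes hol: "G holomorphic_on {z. Im z > 0}"
    and neg: "\<And>z. Im z > 0 \<Longrightarrow> Im (G z) \<le> 0"
    and bd: "\<And>z. Im z > 0 \<Longrightarrow> norm (G z) \<le> 1 / Im z"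
    and lim: "((\<lambda>y. \<i> * complex_of_real y * G (\<i> * complex_of_real y)) \<longlongrightarrow> 1) at_top"
    and e: "e > 0"
  shows "\<exists>\<rho>. real_distribution \<rho> \<and>
    (\<forall>z. Im z > 0 \<longrightarrow> cauchy_transform \<rho> z = G (z + \<i> * complex_of_real e))"
proof -
  define g where "g z = G (z + \<i> * complex_of_real e)" for z
  define p where "p x = - Im (g (complex_of_real x)) / pi" for x
  have holg: "g holomorphic_on {z. Im z > - e}"
    unfolding g_def
    by (rule holomorphic_on_compose_gen[OF _ hol, unfolded o_def]) (auto intro!: holomorphic_intros)
  have B: "norm (g w) \<le> 1 / e" if "Im w \<ge> 0" for w
  proof -
    have "norm (g w) \<le> 1 / Im (w + \<i> * complex_of_real e)"
      unfolding g_def using that e by (intro bd) simp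
    also have "\<dots> \<le> 1 / e" using that e by (simp add: frac_le)
    finally show ?thesis .
  qed
  have negg: "Im (g w) \<le> 0" if "Im w \<ge> 0" for w
    unfolding g_def using that e by (intro neg) simp
  have p0: "p x \<ge> 0" for x using negg[of "complex_of_real x"] by (simp add: p_def divide_simps)
  have pois: "has_bochner_integral lborel
      (\<lambda>x. p x * (Im z / (norm (complex_of_real x - z))\<^sup>2)) (- Im (g z))" if "Im z > 0" for z
    using poisson_half_plane_Im[OF e holg B that] negg by (simp add: p_def)
  have contg: "continuous_on UNIV (\<lambda>x. g (complex_of_real x))"
    using e by (intro continuous_on_compose2[OF holomorphic_on_imp_continuous_on[OF holg]] continuous_intros) auto
  have contp: "continuous_on UNIV p"
    unfolding p_def by (intro continuous_intros contg) auto
  have measp [measurable]: "p \<in> borel_measurable borel"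
    by (rule borel_measurable_continuous_onI[OF contp])
  have mass: "has_bochner_integral lborel p 1"
  proof -
    \<comment> \<open>With \<open>y = Suc n\<close> this is \<open>y\<close> times the integrand of
      \<open>pois\<close> at \<open>z = \<i> * y\<close>. It increases to \<open>p x\<close>, so
      monotone convergence identifies the total mass with the limit of
      \<open>- y * Im (g (\<i> * y))\<close>.\<close>
    let ?f = "\<lambda>n x. p x * ((real (Suc n))\<^sup>2 / (x\<^sup>2 + (real (Suc n))\<^sup>2))"
    have hb: "has_bochner_integral lborel (?f n) (- real (Suc n) * Im (g (\<i> * complex_of_real (real (Suc n)))))" for n
    proof -
      have "has_bochner_integral lborel
          (\<lambda>x. real (Suc n) * (p x * (Im (\<i> * complex_of_real (real (Suc n))) / (norm (complex_of_real x - \<i> * complex_of_real (real (Suc n))))\<^sup>2)))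
          (real (Suc n) * (- Im (g (\<i> * complex_of_real (real (Suc n))))))"
        by (intro has_bochner_integral_mult_right pois) simp
      moreover have "real (Suc n) * (p x * (Im (\<i> * complex_of_real (real (Suc n))) / (norm (complex_of_real x - \<i> * complex_of_real (real (Suc n))))\<^sup>2)) = ?f n x" for x
      proof -
        have norm2: "(norm (complex_of_real x - \<i> * complex_of_real a))\<^sup>2 = x\<^sup>2 + a\<^sup>2" for a
          by (simp add: cmod_power2)
        show ?thesis unfolding norm2 by (simp add: power2_eq_square del: of_nat_Suc)
      qed
      ultimately show ?thesis by (simp only: mult_minus_left mult_minus_right)
    qed
    have int: "integrable lborel (?f n)" for n
      using hb[of n] by (simp add: has_bochner_integral_iff)
    have mono: "AE x in lborel. mono (\<lambda>n. ?f n x)"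
    proof (intro AE_I2 monoI mult_left_mono p0)
      fix x :: real and m n :: nat assume "m \<le> n"
      then have le: "(real (Suc m))\<^sup>2 \<le> (real (Suc n))\<^sup>2" by (intro power_mono) auto
      show "(real (Suc m))\<^sup>2 / (x\<^sup>2 + (real (Suc m))\<^sup>2) \<le> (real (Suc n))\<^sup>2 / (x\<^sup>2 + (real (Suc n))\<^sup>2)"
        by (rule divide_add_self_mono) (use le in auto)
    qed
    have pos: "AE x in lborel. 0 \<le> ?f n x" for n
      using p0 by (intro AE_I2 mult_nonneg_nonneg) auto
    have lims: "AE x in lborel. (\<lambda>n. ?f n x) \<longlonglongrightarrow> p x"
    proof (rule AE_I2)
      fix x :: real
      have "(\<lambda>n. (real (Suc n))\<^sup>2 / (x\<^sup>2 + (real (Suc n))\<^sup>2)) \<longlonglongrightarrow> 1" by real_asymp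
      from tendsto_mult[OF tendsto_const[of "p x"] this]
      show "(\<lambda>n. ?f n x) \<longlonglongrightarrow> p x" by simp
    qed
    have ilim: "(\<lambda>n. integral\<^sup>L lborel (?f n)) \<longlonglongrightarrow> 1"
    proof -
      \<comment> \<open>Since \<open>g\<close> is \<open>G\<close> shifted by \<open>e\<close>, the
        hypothesis controls the imaginary part with weight \<open>Suc n + e\<close>; the ratio
        \<open>Suc n / (Suc n + e)\<close> restores the weight \<open>Suc n\<close>.\<close>
      have ft: "filterlim (\<lambda>n. real (Suc n) + e) at_top sequentially" by real_asymp
      have "(\<lambda>n. Re (\<i> * complex_of_real (real (Suc n) + e) * G (\<i> * complex_of_real (real (Suc n) + e)))) \<longlonglongrightarrow> Re 1"
        by (intro tendsto_Re filterlim_compose[OF lim ft])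
      then have "(\<lambda>n. - (real (Suc n) + e) * Im (g (\<i> * complex_of_real (real (Suc n))))) \<longlonglongrightarrow> 1"
        by (simp add: g_def algebra_simps)
      moreover have "(\<lambda>n. real (Suc n) / (real (Suc n) + e)) \<longlonglongrightarrow> 1" by real_asymp
      ultimately have "(\<lambda>n. real (Suc n) / (real (Suc n) + e) * (- (real (Suc n) + e) * Im (g (\<i> * complex_of_real (real (Suc n)))))) \<longlonglongrightarrow> 1 * 1"
        by (intro tendsto_mult)
      moreover have "real (Suc n) / (real (Suc n) + e) * (- (real (Suc n) + e) * c) = - real (Suc n) * c" for n c
      proof -
        have "real (Suc n) + e \<noteq> 0" using e by (simp add: add_nonneg_eq_0_iff)
        then show ?thesis by (simp add: field_simps)
      qed
      ultimately show ?thesis by (simp only: has_bochner_integral_integral_eq[OF hb] mult_1)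
    qed
    have "integrable lborel p" "integral\<^sup>L lborel p = 1"
      using integral_monotone_convergence_nonneg[OF int mono pos lims ilim] by auto
    then show ?thesis by (simp add: has_bochner_integral_iff)
  qed
  define \<rho> where "\<rho> = density lborel p"
  have "emeasure \<rho> UNIV = 1"
    unfolding \<rho>_def using mass p0
    by (simp add: emeasure_density nn_integral_eq_integral has_bochner_integral_iff)
  then have \<rho>: "real_distribution \<rho>"
    unfolding real_distribution_def real_distribution_axioms_def \<rho>_def
    by (auto intro!: prob_spaceI)
  interpret real_distribution \<rho> by fact
  have imeq: "Im (cauchy_transform \<rho> z) = Im (g z)" if "Im z > 0" for z
  proof -
    have "Im (cauchy_transform \<rho> z) = (LINT x|\<rho>. Im (1 / (z - complex_of_real x)))"
      unfolding cauchy_transform_def using that by (subst integral_Im) auto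
    also have "\<dots> = (LINT x|lborel. p x *\<^sub>R Im (1 / (z - complex_of_real x)))"
      unfolding \<rho>_def using p0 by (intro integral_density) auto
    also have "\<dots> = (LINT x|lborel. - (p x * (Im z / (norm (complex_of_real x - z))\<^sup>2)))"
      by (intro Bochner_Integration.integral_cong)
        (auto simp: Im_cauchy_kernel[OF that] norm_divide power_divide norm_minus_commute)
    also have "\<dots> = Im (g z)"
      using pois[OF that] by (simp add: has_bochner_integral_iff)
    finally show ?thesis .
  qed
  define D where "D z = cauchy_transform \<rho> z - g z" for z
  have "D constant_on {z. Im z > 0}"
  proof (rule holomorphic_Im_0_imp_constant_on)
    show "D holomorphic_on {z. Im z > 0}"
      unfolding D_def using e
      by (intro holomorphic_intros cauchy_transform_holomorphic holomorphic_on_subset[OF holg]) auto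
    show "connected {z. Im z > 0}" by (intro convex_connected convex_halfspace_Im_gt)
  qed (auto simp: D_def imeq open_halfspace_Im_gt)
  then obtain c where c: "\<And>z. Im z > 0 \<Longrightarrow> D z = c" by (auto simp: constant_on_def)
  have "((\<lambda>y. D (\<i> * complex_of_real y)) \<longlongrightarrow> 0) at_top"
  proof (rule Lim_null_comparison)
    show "\<forall>\<^sub>F y in at_top. norm (D (\<i> * complex_of_real y)) \<le> 1 / y + 1 / y"
      using eventually_gt_at_top[of 0]
    proof eventually_elim
      case (elim y)
      have "norm (cauchy_transform \<rho> (\<i> * complex_of_real y)) \<le> 1 / y"
      proof -
        have "norm (cauchy_transform \<rho> (\<i> * complex_of_real y)) \<le> (LINT x|\<rho>. 1 / y)"
          unfolding cauchy_transform_def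
          by (rule order_trans[OF integral_norm_bound], rule integral_mono)
            (use elim norm_cauchy_kernel_le[of "\<i> * complex_of_real y"] in auto)
        then show ?thesis by (simp add: prob_UNIV)
      qed
      moreover have "norm (g (\<i> * complex_of_real y)) \<le> 1 / y"
      proof -
        have "norm (g (\<i> * complex_of_real y)) \<le> 1 / Im (\<i> * complex_of_real y + \<i> * complex_of_real e)"
          unfolding g_def using elim e by (intro bd) simp
        also have "\<dots> \<le> 1 / y" using elim e by (simp add: frac_le)
        finally show ?thesis .
      qed
      ultimately show ?case
        unfolding D_def by (intro order_trans[OF norm_triangle_ineq4] add_mono)
    qed
    show "((\<lambda>y::real. 1 / y + 1 / y) \<longlongrightarrow> 0) at_top" by real_asymp
  qed
  moreover have "((\<lambda>y. D (\<i> * complex_of_real y)) \<longlongrightarrow> c) at_top"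
    by (rule tendsto_eventually) (use eventually_gt_at_top[of "0::real"] in eventually_elim, auto intro!: c)
  ultimately have "c = 0" by (intro tendsto_unique) auto
  then have "cauchy_transform \<rho> z = G (z + \<i> * complex_of_real e)" if "Im z > 0" for z
    using c[OF that] by (simp add: D_def g_def)
  then show ?thesis using \<rho> by blast
qed

lemma (in real_distribution) Im_cauchy_transform_ii:
  assumes "y > 0"
  shows "- y * Im (cauchy_transform M (\<i> * complex_of_real y)) = (LINT x|M. y\<^sup>2 / (x\<^sup>2 + y\<^sup>2))"
proof -
  have "Im (cauchy_transform M (\<i> * complex_of_real y)) = (LINT x|M. Im (1 / (\<i> * complex_of_real y - complex_of_real x)))"
    unfolding cauchy_transform_def using assms by (subst integral_Im) auto
  also have "\<dots> = (LINT x|M. - (y / (x\<^sup>2 + y\<^sup>2)))"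
    by (simp add: Im_divide)
  finally have "- y * Im (cauchy_transform M (\<i> * complex_of_real y)) = (LINT x|M. y * (y / (x\<^sup>2 + y\<^sup>2)))"
    by (simp only: integral_mult_right_zero integral_minus mult_minus_left mult_minus_right minus_minus)
  then show ?thesis by (simp add: power2_eq_square)
qed

text \<open>The function \<open>y^2 / (x^2 + y^2)\<close> is at most \<open>1\<close> on the
  interval and at most \<open>1/2\<close> off it, so its mean bounds the mass of the interval from
  below. This yields tightness from values on the imaginary axis.\<close>

lemma (in real_distribution) prob_Ioc_ge:
  assumes "y > 0"
  shows "prob {-y<..y} \<ge> 2 * (- y * Im (cauchy_transform M (\<i> * complex_of_real y))) - 1"
proof -
  have pos: "x\<^sup>2 + y\<^sup>2 > 0" for x using assms by (intro add_nonneg_pos) auto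
  have "(LINT x|M. y\<^sup>2 / (x\<^sup>2 + y\<^sup>2)) \<le> (LINT x|M. 1/2 + 1/2 * indicator {-y<..y} x)"
  proof (rule integral_mono)
    show "integrable M (\<lambda>x. y\<^sup>2 / (x\<^sup>2 + y\<^sup>2))"
    proof (rule integrable_const_bound[where B = 1])
      show "AE x in M. norm (y\<^sup>2 / (x\<^sup>2 + y\<^sup>2)) \<le> 1"
        using pos by (intro AE_I2) (auto simp: divide_le_eq)
    qed simp
    show "integrable M (\<lambda>x. 1/2 + 1/2 * indicator {-y<..y} x :: real)"
      by (rule integrable_const_bound[where B = 1]) (auto simp: indicator_def)
    fix x
    show "y\<^sup>2 / (x\<^sup>2 + y\<^sup>2) \<le> 1/2 + 1/2 * indicator {-y<..y} x"
    proof (cases "x \<in> {-y<..y}")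
      case True
      then show ?thesis using pos[of x] by (simp add: divide_le_eq)
    next
      case False
      then have "y \<le> \<bar>x\<bar>" by auto
      then have "y\<^sup>2 \<le> x\<^sup>2" using assms by (simp add: abs_le_square_iff[symmetric])
      then show ?thesis using False pos[of x] by (simp add: divide_le_eq)
    qed
  qed
  also have "\<dots> = 1/2 + 1/2 * prob {-y<..y}" 
  proof -
    have "integrable M (\<lambda>x. 1/2 * indicator {-y<..y} x :: real)"
      by (rule integrable_const_bound[where B = 1]) (auto simp: indicator_def)
    then have "(LINT x|M. 1/2 + 1/2 * indicator {-y<..y} x) = (LINT x|M. 1/2 :: real) + (LINT x|M. 1/2 * indicator {-y<..y} x)"
      by (intro Bochner_Integration.integral_add) auto
    then show ?thesis by (simp add: prob_UNIV)
  qed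
  finally show ?thesis using Im_cauchy_transform_ii[OF assms] by simp
qed

text \<open>Tightness is uniform in the shift because every shifted transform is governed by the
  same asymptotics on the imaginary axis. Along a weakly convergent subsequence the transforms
  converge, the kernel being bounded and continuous in \<open>x\<close>, and continuity of
  \<open>G\<close> identifies the limit.\<close>

theorem cauchy_transform_characterization:
  assumes hol: "G holomorphic_on {z. Im z > 0}"
    and neg: "\<And>z. Im z > 0 \<Longrightarrow> Im (G z) \<le> 0"
    and bd: "\<And>z. Im z > 0 \<Longrightarrow> norm (G z) \<le> 1 / Im z"
    and lim: "((\<lambda>y. \<i> * complex_of_real y * G (\<i> * complex_of_real y)) \<longlongrightarrow> 1) at_top"
  shows "\<exists>\<rho>. real_distribution \<rho> \<and> (\<forall>z. Im z > 0 \<longrightarrow> cauchy_transform \<rho> z = G z)"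
proof -
  define e where "e n = 1 / real (Suc n)" for n
  have e: "e n > 0" "e n \<le> 1" for n by (auto simp: e_def divide_simps)
  have "\<exists>\<rho>. real_distribution \<rho> \<and> (\<forall>z. Im z > 0 \<longrightarrow> cauchy_transform \<rho> z = G (z + \<i> * complex_of_real (e n)))" for n
    by (rule smoothed_cauchy_transform[OF hol neg bd lim e(1)])
  then obtain \<rho> where \<rho>: "\<And>n. real_distribution (\<rho> n)"
    "\<And>n z. Im z > 0 \<Longrightarrow> cauchy_transform (\<rho> n) z = G (z + \<i> * complex_of_real (e n))"
    by metis
  have "tight \<rho>"
    unfolding tight_def
  proof (intro conjI allI impI \<rho>(1))
    fix \<epsilon> :: real assume \<epsilon>: "\<epsilon> > 0"
    \<comment> \<open>The mass estimate will be
      \<open>2 * (1 - 2 * \<eta>) - 1 = 1 - 4 * \<eta>\<close>, which must exceed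
      \<open>1 - \<epsilon>\<close>; the cap \<open>1/2\<close> keeps \<open>1 - \<eta>\<close>
      positive in the product estimate.\<close>
    define \<eta> where "\<eta> = min (1/2) (\<epsilon> / 5)"
    have \<eta>: "\<eta> > 0" "\<eta> \<le> 1/2" "4 * \<eta> < \<epsilon>" using \<epsilon> by (auto simp: \<eta>_def)
    have "((\<lambda>y. Re (\<i> * complex_of_real y * G (\<i> * complex_of_real y))) \<longlongrightarrow> Re 1) at_top"
      by (intro tendsto_Re lim)
    then have "((\<lambda>y. - y * Im (G (\<i> * complex_of_real y))) \<longlongrightarrow> 1) at_top" by simp
    from order_tendstoD(1)[OF this, of "1 - \<eta>"] \<eta>(1)
    obtain Y where Y: "\<And>y. y \<ge> Y \<Longrightarrow> 1 - \<eta> < - y * Im (G (\<i> * complex_of_real y))"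
      by (auto simp: eventually_at_top_linorder)
    \<comment> \<open>\<open>K \<ge> 1 / \<eta>\<close> makes
      \<open>K / (K + 1) \<ge> 1 - \<eta>\<close>; since \<open>e n \<le> 1\<close>, one
      \<open>K\<close> serves all \<open>n\<close>.\<close>
    define K where "K = max Y (1 / \<eta>)"
    have K: "K \<ge> Y" "K \<ge> 1 / \<eta>" "K > 0" using \<eta> by (auto simp: K_def less_max_iff_disj)
    have K1: "K / (K + 1) \<ge> 1 - \<eta>"
    proof -
      have "\<eta> * (K + 1) \<ge> 1" using K(2) \<eta>(1) by (simp add: divide_le_eq algebra_simps add_increasing2)
      then show ?thesis using K(3) by (simp add: le_divide_eq algebra_simps)
    qed
    have "measure (\<rho> n) {-K<..K} > 1 - \<epsilon>" for n
    proof -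
      interpret real_distribution "\<rho> n" by (rule \<rho>)
      define b where "b = - (K + e n) * Im (G (\<i> * complex_of_real (K + e n)))"
      have b: "b > 1 - \<eta>" unfolding b_def using K e(1)[of n] by (intro Y) simp
      have "- K * Im (cauchy_transform (\<rho> n) (\<i> * complex_of_real K)) = K / (K + e n) * b"
      proof -
        have "K + e n \<noteq> 0" using K e(1)[of n] by simp
        moreover have "cauchy_transform (\<rho> n) (\<i> * complex_of_real K) = G (\<i> * complex_of_real (K + e n))"
          using \<rho>(2)[of "\<i> * complex_of_real K" n] K by (simp add: algebra_simps)
        ultimately show ?thesis by (simp add: b_def field_simps del: of_real_add)
      qed
      also have "\<dots> \<ge> (1 - \<eta>) * (1 - \<eta>)"
      proof (rule mult_mono)
        have "K / (K + 1) \<le> K / (K + e n)" using K e[of n] by (intro divide_left_mono) auto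
        then show "1 - \<eta> \<le> K / (K + e n)" using K1 by linarith
      qed (use b \<eta> K e(1)[of n] in auto)
      finally have low: "(1 - \<eta>) * (1 - \<eta>) \<le> - K * Im (cauchy_transform (\<rho> n) (\<i> * complex_of_real K))" .
      then have "- K * Im (cauchy_transform (\<rho> n) (\<i> * complex_of_real K)) \<ge> 1 - 2 * \<eta>"
      proof -
        have "(1 - \<eta>) * (1 - \<eta>) = 1 - 2 * \<eta> + \<eta> * \<eta>" by (simp add: algebra_simps)
        then show ?thesis using zero_le_square[of \<eta>] low by linarith
      qed
      then show ?thesis using prob_Ioc_ge[OF K(3)] \<eta>(3) by linarith
    qed
    then show "\<exists>a b. a < b \<and> (\<forall>n. 1 - \<epsilon> < measure (\<rho> n) {a<..b})"
      using K(3) by (intro exI[of _ "-K"] exI[of _ K]) auto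
  qed
  from tight_imp_convergent_subsubsequence[OF this strict_mono_id]
  obtain r \<mu> where r: "strict_mono (r :: nat \<Rightarrow> nat)" and \<mu>: "real_distribution \<mu>"
    and conv: "weak_conv_m (\<rho> \<circ> r) \<mu>"
    by auto
  interpret real_distribution \<mu> by fact
  have "cauchy_transform \<mu> z = G z" if z: "Im z > 0" for z
  proof -
    have "(\<lambda>n. cauchy_transform ((\<rho> \<circ> r) n) z) \<longlonglongrightarrow> cauchy_transform \<mu> z"
      unfolding cauchy_transform_def
    proof (rule weak_conv_imp_integral_bdd_continuous_conv[OF _ \<mu> conv])
      show "isCont (\<lambda>x. 1 / (z - complex_of_real x)) x" for x
        using minus_of_real_neq_0[OF z, of x] by (intro continuous_intros) auto
    qed (use \<rho>(1) norm_cauchy_kernel_le[OF z] in auto)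
    moreover have "(\<lambda>n. cauchy_transform ((\<rho> \<circ> r) n) z) \<longlonglongrightarrow> G z"
    proof -
      have "isCont G z"
        using holomorphic_on_imp_continuous_on[OF hol] z
        by (simp add: continuous_on_eq_continuous_at[OF open_halfspace_Im_gt])
      moreover have "(\<lambda>n. z + \<i> * complex_of_real (e (r n))) \<longlonglongrightarrow> z"
      proof -
        have "e \<longlonglongrightarrow> 0" unfolding e_def by real_asymp
        then have "(\<lambda>n. e (r n)) \<longlonglongrightarrow> 0" using LIMSEQ_subseq_LIMSEQ[OF _ r] by (simp add: o_def)
        then have "(\<lambda>n. z + \<i> * complex_of_real (e (r n))) \<longlonglongrightarrow> z + \<i> * complex_of_real 0"
          by (intro tendsto_intros)
        then show ?thesis by simp
      qed
      ultimately have "(\<lambda>n. G (z + \<i> * complex_of_real (e (r n)))) \<longlonglongrightarrow> G z"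
        by (rule isCont_tendsto_compose)
      then show ?thesis using \<rho>(2)[OF z] by simp
    qed
    ultimately show ?thesis by (rule LIMSEQ_unique)
  qed
  then show ?thesis using \<mu> by blast
qed

section \<open>Existence of Boolean powers\<close>

lemma (in real_distribution) F_transform_ii_tendsto:
  "((\<lambda>y. F_transform M (\<i> * complex_of_real y) / (\<i> * complex_of_real y)) \<longlongrightarrow> 1) at_top"
proof (rule tendstoI)
  fix e :: real assume e: "e > 0"
  obtain K where K: "K > 0" "\<And>z. z \<in> trunc_cone 1 K \<Longrightarrow> norm (F_transform M z - z) \<le> e / 2 * norm z"
    using F_transform_asymp[of 1 "e / 2"] e by auto
  show "\<forall>\<^sub>F y in at_top. dist (F_transform M (\<i> * complex_of_real y) / (\<i> * complex_of_real y)) 1 < e"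
    using eventually_gt_at_top[of K]
  proof eventually_elim
    case (elim y)
    define z where "z = \<i> * complex_of_real y"
    have z0: "z \<noteq> 0" using elim K by (simp add: z_def)
    have "norm (F_transform M z - z) \<le> e / 2 * norm z"
      using K(2)[OF ii_in_trunc_cone[of 1 y K]] elim K by (simp add: z_def)
    also have "\<dots> < e * norm z" using e z0 by simp
    finally have "norm (F_transform M z - z) / norm z < e" using z0 by (simp add: pos_divide_less_eq)
    moreover have "F_transform M z / z - 1 = (F_transform M z - z) / z" using z0 by (simp add: divide_simps)
    ultimately show ?case unfolding z_def[symmetric] by (simp add: dist_norm norm_divide)
  qed
qed

text \<open>For \<open>s > 1\<close> the coefficient of \<open>z\<close> is negative, yet
  \<open>Im (F z) \<ge> Im z\<close> survives because
  \<open>Im (F_transform \<mu> z) \<ge> Im z\<close>. Together with the asymptotics on the imaginary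
  axis this makes \<open>1 / F\<close> a Cauchy transform.\<close>

lemma boolean_power_exists:
  assumes \<mu>: "real_distribution \<mu>" and s: "s \<ge> 0"
  obtains \<rho> where "is_boolean_power \<mu> s \<rho>"
proof -
  interpret real_distribution \<mu> by fact
  define F where "F z = (1 - complex_of_real s) * z + complex_of_real s * F_transform \<mu> z" for z
  have imF: "Im (F z) \<ge> Im z" if "Im z > 0" for z
  proof -
    have eq: "1 - complex_of_real s = complex_of_real (1 - s)" by simp
    have "Im (F z) = (1 - s) * Im z + s * Im (F_transform \<mu> z)" unfolding F_def eq by simp
    moreover have "s * Im (F_transform \<mu> z) \<ge> s * Im z"
      using Im_F_transform_ge[OF that] s by (intro mult_left_mono)
    ultimately show ?thesis by (simp add: algebra_simps)
  qed
  have F0: "F z \<noteq> 0" if "Im z > 0" for z using imF[OF that] that by auto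
  have holF: "F holomorphic_on {z. Im z > 0}"
    unfolding F_def by (intro holomorphic_intros F_transform_holomorphic)
  have hol: "(\<lambda>z. 1 / F z) holomorphic_on {z. Im z > 0}"
      using F0 by (intro holomorphic_intros holF) auto
  have neg: "Im (1 / F z) \<le> 0" if "Im z > 0" for z
      using imF[OF that] that by (simp add: Im_divide divide_nonpos_nonneg)
  have bd: "norm (1 / F z) \<le> 1 / Im z" if "Im z > 0" for z
    proof -
      have "Im z \<le> norm (F z)" using imF[OF that] abs_Im_le_cmod[of "F z"] by linarith
      then show ?thesis using that by (simp add: norm_divide frac_le)
    qed
  have lim: "((\<lambda>y. \<i> * complex_of_real y * (1 / F (\<i> * complex_of_real y))) \<longlongrightarrow> 1) at_top"
    proof -
      have "((\<lambda>y. 1 / ((1 - complex_of_real s) + complex_of_real s * (F_transform \<mu> (\<i> * complex_of_real y) / (\<i> * complex_of_real y)))) \<longlongrightarrow> 1 / ((1 - complex_of_real s) + complex_of_real s * 1)) at_top"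
        by (intro tendsto_intros F_transform_ii_tendsto) auto
      then have "((\<lambda>y. 1 / ((1 - complex_of_real s) + complex_of_real s * (F_transform \<mu> (\<i> * complex_of_real y) / (\<i> * complex_of_real y)))) \<longlongrightarrow> 1) at_top"
        by simp
      then show ?thesis
      proof (rule Lim_transform_eventually)
        show "\<forall>\<^sub>F y in at_top. 1 / ((1 - complex_of_real s) + complex_of_real s * (F_transform \<mu> (\<i> * complex_of_real y) / (\<i> * complex_of_real y)))
            = \<i> * complex_of_real y * (1 / F (\<i> * complex_of_real y))"
          using eventually_gt_at_top[of "0::real"]
        proof eventually_elim
          case (elim y)
          define z where "z = \<i> * complex_of_real y"
          have z0: "z \<noteq> 0" using elim by (simp add: z_def)
          then have "F z = z * ((1 - complex_of_real s) + complex_of_real s * (F_transform \<mu> z / z))"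
            by (simp add: F_def field_simps)
          then show ?case unfolding z_def[symmetric] using z0 by simp
        qed
      qed
    qed
  obtain \<rho> where \<rho>: "real_distribution \<rho>" "\<And>z. Im z > 0 \<Longrightarrow> cauchy_transform \<rho> z = 1 / F z"
    using cauchy_transform_characterization[OF hol neg bd lim] by blast
  have "is_boolean_power \<mu> s \<rho>"
    using \<rho> by (simp add: is_boolean_power_def F_transform_def[of \<rho>] F_def)
  then show ?thesis using that by blast
qed

subsection \<open>The range of \<open>\<B>\<^sub>t\<close>\<close>

text \<open>Iterated convolution multiplies the Voiculescu transform of \<open>\<nu>\<close> by
  \<open>n\<close>. Each convolution step carries its own cone and its own inverses, so the
  induction identifies them on a common smaller cone by uniqueness.\<close>

lemma free_conv_iter_F_inverse:
  assumes "is_free_conv_iter \<nu> n \<sigma>" and \<nu>: "real_distribution \<nu>"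
  shows "real_distribution \<sigma> \<and> (\<exists>l>0. \<exists>M H\<nu> H\<sigma>. is_F_inverse \<nu> l M H\<nu> \<and> is_F_inverse \<sigma> l M H\<sigma> \<and>
    (\<forall>z\<in>trunc_cone l M. H\<sigma> z - z = of_nat n * (H\<nu> z - z)))"
  using assms(1)
proof induction
  case one
  interpret real_distribution \<nu> by fact
  obtain K H where "is_F_inverse \<nu> 1 K H" using F_inverse_exists[OF zero_less_one] by metis
  then show ?case using \<nu> by (intro conjI exI[of _ 1] exI[of _ K] exI[of _ H]) auto
next
  case (Suc n \<sigma> \<rho>)
  have \<sigma>: "real_distribution \<sigma>" using Suc.IH by blast
  obtain l1 M1 A1 B1 where l1: "l1 > 0" and A1: "is_F_inverse \<nu> l1 M1 A1" and B1: "is_F_inverse \<sigma> l1 M1 B1"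
    and eq1: "\<And>z. z \<in> trunc_cone l1 M1 \<Longrightarrow> B1 z - z = of_nat n * (A1 z - z)"
    using Suc.IH by blast
  obtain l2 M2 A2 B2 C where l2: "l2 > 0" and B2: "is_F_inverse \<sigma> l2 M2 B2"
    and A2: "is_F_inverse \<nu> l2 M2 A2" and C: "is_F_inverse \<rho> l2 M2 C"
    and eq2: "\<And>z. z \<in> trunc_cone l2 M2 \<Longrightarrow> C z - z = (B2 z - z) + (A2 z - z)"
    using Suc.hyps(2) unfolding is_free_conv_def is_voiculescu_def by (metis (no_types))
  define l where "l = min l1 l2"
  have l: "l > 0" "l \<le> l1" "l \<le> l2" using l1 l2 by (auto simp: l_def)
  obtain Ma where Ma: "Ma \<ge> M1" "Ma \<ge> M2" "\<And>z. z \<in> trunc_cone l Ma \<Longrightarrow> A1 z = A2 z"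
    using F_inverse_unique[OF \<nu> is_F_inverse_subset[OF A1 trunc_cone_mono[OF l(2) order_refl]]
        is_F_inverse_subset[OF A2 trunc_cone_mono[OF l(3) order_refl]] l(1)] by metis
  obtain Mb where Mb: "Mb \<ge> M1" "Mb \<ge> M2" "\<And>z. z \<in> trunc_cone l Mb \<Longrightarrow> B1 z = B2 z"
    using F_inverse_unique[OF \<sigma> is_F_inverse_subset[OF B1 trunc_cone_mono[OF l(2) order_refl]]
        is_F_inverse_subset[OF B2 trunc_cone_mono[OF l(3) order_refl]] l(1)] by metis
  define K where "K = max Ma Mb"
  have sub: "trunc_cone l K \<subseteq> trunc_cone l1 M1" "trunc_cone l K \<subseteq> trunc_cone l2 M2"
      "trunc_cone l K \<subseteq> trunc_cone l Ma" "trunc_cone l K \<subseteq> trunc_cone l Mb"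
    by (rule trunc_cone_mono; use l Ma Mb in \<open>simp add: K_def\<close>)+
  have "C z - z = of_nat (Suc n) * (A1 z - z)" if z: "z \<in> trunc_cone l K" for z
  proof -
    have "C z - z = (B1 z - z) + (A1 z - z)"
      using eq2 Ma(3) Mb(3) z sub by (metis subsetD)
    also have "B1 z - z = of_nat n * (A1 z - z)" using eq1[of z] z sub by auto
    finally show ?thesis by (simp add: algebra_simps)
  qed
  moreover have "real_distribution \<rho>" using Suc.hyps(2) by (simp add: is_free_conv_def)
  ultimately show ?case
    using is_F_inverse_subset[OF A1 sub(1)] is_F_inverse_subset[OF C sub(2)] l(1) by blast
qed

text \<open>The subordination function \<open>(z + (n - 1) F\<^sub>\<mu> z) / n\<close> of \<open>\<mu>\<close> over \<open>\<nu>\<close> is also that of the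
  Boolean power \<open>R\<close> of \<open>\<mu>\<close> of order \<open>1 + t\<close> over the Boolean power \<open>N\<close> of \<open>\<nu>\<close> of order \<open>n\<close>.\<close>

lemma free_conv_iter_imp_BB_range:
  assumes \<nu>: "real_distribution \<nu>" and iter: "is_free_conv_iter \<nu> n \<mu>" and n: "n \<ge> 1"
  shows "\<mu> \<in> BB_range (1 - 1 / real n)"
proof -
  define t where "t = 1 - 1 / real n"
  have t: "t \<ge> 0" "1 - t = 1 / real n" using n by (auto simp: t_def)
  define T where "T = complex_of_real t"
  have T1: "1 + T \<noteq> 0" using t(1) by (auto simp: T_def complex_eq_iff)
  have Tn: "of_nat n * (1 - T) = 1"
  proof -
    have "complex_of_real (real n * (1 - t)) = 1" using n t(2) by simp
    then show ?thesis by (simp add: T_def)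
  qed
  have n0: "(of_nat n :: complex) \<noteq> 0" using n by simp
  have \<mu>: "real_distribution \<mu>" using free_conv_iter_F_inverse[OF iter \<nu>] by blast
  interpret \<mu>: real_distribution \<mu> by fact
  obtain l M A B where "l > 0" "is_F_inverse \<nu> l M A" "is_F_inverse \<mu> l M B"
    "\<And>z. z \<in> trunc_cone l M \<Longrightarrow> B z - z = complex_of_real (real n) * (A z - z)"
    using free_conv_iter_F_inverse[OF iter \<nu>] by (metis of_real_of_nat_eq)
  then have sub: "F_transform \<nu> ((z + (of_nat n - 1) * F_transform \<mu> z) / of_nat n) = F_transform \<mu> z"
    if "Im z > 0" for z
    using free_power_subordination[OF \<nu> \<mu>, of "real n" l M A B z] n that by simp
  obtain N where N: "is_boolean_power \<nu> (real n) N"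
    using boolean_power_exists[OF \<nu>, of "real n"] by auto
  \<comment> \<open>\<open>R\<close> is built so that its Boolean power of order
    \<open>1 / (1 + t)\<close> is \<open>\<mu>\<close>; what has to be shown is that it is the free
    power of order \<open>1 + t\<close> of \<open>N\<close>.\<close>
  obtain R where R: "is_boolean_power \<mu> (1 + t) R"
    using boolean_power_exists[OF \<mu>, of "1 + t"] t(1) by auto
  have rN: "real_distribution N" and rR: "real_distribution R"
    using N R by (auto simp: is_boolean_power_def)
  have FR: "F_transform R z = (1 + T) * F_transform \<mu> z - T * z" if "Im z > 0" for z
    using R that by (simp add: is_boolean_power_def T_def algebra_simps)
  interpret R: real_distribution R by fact
  obtain K H where K: "K > 0" and H: "is_F_inverse R 1 K H"
    using R.F_inverse_exists[of 1] by auto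
  \<comment> \<open>Obtained by solving \<open>H w - w = (1 + t) * (L w - w)\<close> for
    \<open>L w\<close>: the inverse that \<open>N\<close> must have if \<open>R\<close> is its free
    power of order \<open>1 + t\<close>.\<close>
  define L where "L w = (H w + T * w) / (1 + T)" for w
  have FN: "F_transform N (L w) = w \<and> Im (L w) > 0" if w: "w \<in> trunc_cone 1 K" for w
  proof -
    define z where "z = H w"
    have z: "Im z > 0" "F_transform R z = w"
      using H w by (auto simp: is_F_inverse_def z_def)
    have imw: "Im w > 0" using w Im_pos_trunc_cone by blast
    have "L w = complex_of_real (1 / (1 + t)) * (z + T * w)"
      by (simp add: L_def z_def T_def)
    then have "Im (L w) = 1 / (1 + t) * (Im z + t * Im w)" by (simp add: T_def)
    then have imL: "Im (L w) > 0"
      using t(1) z(1) imw by (auto intro!: divide_pos_pos add_pos_nonneg)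
    \<comment> \<open>\<open>L w\<close> is a convex combination of \<open>z\<close> and
      \<open>F_transform \<mu> z\<close>; because \<open>1 - t = 1 / n\<close> it is the point at
      which subordination of \<open>\<mu>\<close> over \<open>\<nu>\<close> applies.\<close>
    have Lw: "L w = (1 - T) * z + T * F_transform \<mu> z"
    proof -
      have "L w * (1 + T) = ((1 - T) * z + T * F_transform \<mu> z) * (1 + T)"
      proof -
        have "L w * (1 + T) = z + T * w" using T1 by (simp add: L_def z_def)
        also have "\<dots> = z + T * ((1 + T) * F_transform \<mu> z - T * z)" using FR[OF z(1)] z(2) by simp
        finally show ?thesis by (simp add: algebra_simps)
      qed
      then show ?thesis using T1 by simp
    qed
    have "(z + (of_nat n - 1) * F_transform \<mu> z) / of_nat n = L w"
    proof -
      have "of_nat n * L w = (of_nat n * (1 - T)) * z + (of_nat n - of_nat n * (1 - T)) * F_transform \<mu> z"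
        unfolding Lw by (simp add: algebra_simps)
      then show ?thesis unfolding Tn using n0 by (simp add: field_simps)
    qed
    then have "F_transform \<nu> (L w) = F_transform \<mu> z" using sub[OF z(1)] by simp
    then have "F_transform N (L w) = (1 - of_nat n) * L w + of_nat n * F_transform \<mu> z"
      using N imL by (simp add: is_boolean_power_def)
    also have "\<dots> = w"
    proof -
      have "(1 - of_nat n) * L w = L w - (of_nat n * (1 - T)) * z - (of_nat n - of_nat n * (1 - T)) * F_transform \<mu> z"
        unfolding Lw by (simp add: algebra_simps)
      then have "(1 - of_nat n) * L w + of_nat n * F_transform \<mu> z = L w - z + F_transform \<mu> z"
        unfolding Tn by (simp add: algebra_simps)
      also have "\<dots> = (1 + T) * F_transform \<mu> z - T * z" unfolding Lw by (simp add: algebra_simps)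
      finally show ?thesis using FR[OF z(1)] z(2) by simp
    qed
    finally show ?thesis using imL by simp
  qed
  have L: "is_F_inverse N 1 K L"
    unfolding is_F_inverse_def
  proof (intro conjI ballI)
    show "L holomorphic_on trunc_cone 1 K"
      unfolding L_def using H T1 by (intro holomorphic_intros) (auto simp: is_F_inverse_def)
    have "((\<lambda>z. H z / z) \<longlongrightarrow> 1) (inf at_infinity (principal (trunc_cone 1 K)))"
      using H by (simp add: is_F_inverse_def)
    then have "((\<lambda>z. (H z / z + T) / (1 + T)) \<longlongrightarrow> (1 + T) / (1 + T)) (inf at_infinity (principal (trunc_cone 1 K)))"
      using T1 by (intro tendsto_intros)
    then have "((\<lambda>z. (H z / z + T) / (1 + T)) \<longlongrightarrow> 1) (inf at_infinity (principal (trunc_cone 1 K)))"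
      using T1 by simp
    then show "((\<lambda>z. L z / z) \<longlongrightarrow> 1) (inf at_infinity (principal (trunc_cone 1 K)))"
    proof (rule Lim_transform_eventually)
      have "(H z / z + T) / (1 + T) = L z / z" if "z \<in> trunc_cone 1 K" for z
      proof -
        have "z \<noteq> 0" using Im_pos_trunc_cone[OF that] by auto
        then have "H z / z + T = (H z + T * z) / z" by (simp add: add_divide_distrib)
        then show ?thesis by (simp add: L_def mult.commute)
      qed
      then show "\<forall>\<^sub>F z in inf at_infinity (principal (trunc_cone 1 K)). (H z / z + T) / (1 + T) = L z / z"
        unfolding eventually_inf_principal by (intro always_eventually) blast
    qed
  qed (use FN in auto)
  have "is_free_power N (1 + t) R"
    unfolding is_free_power_def is_voiculescu_def
  proof (intro conjI rR exI)
    show "\<forall>z\<in>trunc_cone 1 K. H z - z = complex_of_real (1 + t) * (L z - z)"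
    proof
      fix z
      have "(1 + T) * L z = H z + T * z" using T1 by (simp add: L_def)
      then show "H z - z = complex_of_real (1 + t) * (L z - z)"
        by (simp add: T_def[symmetric] algebra_simps)
    qed
  qed (use K L H in auto)
  moreover have "is_boolean_power R (1 / (1 + t)) \<mu>"
    unfolding is_boolean_power_def
  proof (intro conjI \<mu> allI impI)
    fix z :: complex assume z: "Im z > 0"
    have "complex_of_real (1 / (1 + t)) = 1 / (1 + T)" by (simp add: T_def)
    moreover have "F_transform \<mu> z = (1 - 1 / (1 + T)) * z + 1 / (1 + T) * F_transform R z"
    proof -
      define q where "q = 1 / (1 + T)"
      have q: "q * (1 + T) = 1" using T1 by (simp add: q_def)
      have "(1 - q) * z + q * F_transform R z = z - (q * (1 + T)) * z + (q * (1 + T)) * F_transform \<mu> z"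
        unfolding FR[OF z] by (simp add: algebra_simps)
      then show ?thesis unfolding q q_def[symmetric] by simp
    qed
    ultimately show "F_transform \<mu> z = (1 - complex_of_real (1 / (1 + t))) * z + complex_of_real (1 / (1 + t)) * F_transform R z"
      by simp
  qed
  ultimately show ?thesis
    using rN unfolding BB_range_def is_BB_def t_def[symmetric] by blast
qed

section \<open>Injectivity along the imaginary axis and the bound \<open>t \<le> 1\<close>\<close>

lemma BB_range_imp_inj_on:
  assumes \<mu>: "real_distribution \<mu>" and BB: "\<mu> \<in> BB_range t" and t: "t \<ge> 1"
    and ext: "extends_F f \<mu>" and U: "open U" "imag_line S \<subseteq> U" "f holomorphic_on U"
    and im: "f ` imag_line S \<subseteq> imag_line {0<..}" and S: "connected S" "{0<..} \<subseteq> S"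
  defines "w \<equiv> \<lambda>y. t * Im (f (\<i> * complex_of_real y)) - (t - 1) * y"
  shows "inj_on w S" "continuous_on S w" "\<And>y. y > 0 \<Longrightarrow> w y \<ge> y"
proof -
  interpret \<mu>: real_distribution \<mu> by fact
  define T where "T = complex_of_real t"
  have T1: "1 + T \<noteq> 0" using t by (auto simp: T_def complex_eq_iff)
  obtain \<nu> \<rho> where \<nu>: "real_distribution \<nu>" and fp: "is_free_power \<nu> (1 + t) \<rho>"
    and bp: "is_boolean_power \<rho> (1 / (1 + t)) \<mu>"
    using BB unfolding BB_range_def is_BB_def by blast
  interpret \<nu>: real_distribution \<nu> by fact
  have \<rho>: "real_distribution \<rho>" using fp by (simp add: is_free_power_def)
  obtain l M A B where "l > 0" "is_F_inverse \<nu> l M A" "is_F_inverse \<rho> l M B"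
    "\<And>z. z \<in> trunc_cone l M \<Longrightarrow> B z - z = complex_of_real (1 + t) * (A z - z)"
    using fp unfolding is_free_power_def is_voiculescu_def by (metis (no_types))
  then have sub: "F_transform \<nu> ((z + T * F_transform \<rho> z) / (1 + T)) = F_transform \<rho> z" if "Im z > 0" for z
    using free_power_subordination[OF \<nu> \<rho>, of "1 + t" l M A B z] t that by (simp add: T_def)
  have F\<rho>: "F_transform \<rho> z = (1 + T) * F_transform \<mu> z - T * z" if "Im z > 0" for z
  proof -
    have "complex_of_real (1 / (1 + t)) = 1 / (1 + T)" by (simp add: T_def)
    then have eq: "F_transform \<mu> z = (1 - 1 / (1 + T)) * z + 1 / (1 + T) * F_transform \<rho> z"
      using bp that unfolding is_boolean_power_def by metis
    have "(1 + T) * F_transform \<mu> z = (1 + T) * z - ((1 + T) * (1 / (1 + T))) * z + ((1 + T) * (1 / (1 + T))) * F_transform \<rho> z"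
      unfolding eq by (simp only: ring_distribs mult.assoc mult_1 mult_1_right)
    also have "\<dots> = T * z + F_transform \<rho> z" using T1 by (simp add: algebra_simps)
    finally show ?thesis by simp
  qed
  obtain V where V: "open V" "imag_line {0<..} \<subseteq> V" "\<And>z. z \<in> V \<Longrightarrow> Im z > 0 \<Longrightarrow> f z = F_transform \<mu> z"
    using ext unfolding extends_F_def by blast
  \<comment> \<open>Where \<open>f\<close> agrees with \<open>F_transform \<mu>\<close>, this is the
    subordination function \<open>(z + T * F_transform \<rho> z) / (1 + T)\<close>; written in terms
    of \<open>f\<close> it extends to \<open>U\<close>.\<close>
  define \<Omega> where "\<Omega> z = T * f z - (T - 1) * z" for z
  have holO: "\<Omega> holomorphic_on U" unfolding \<Omega>_def by (intro holomorphic_intros U)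
  have reO: "f (\<i> * complex_of_real y) = \<i> * complex_of_real (Im (f (\<i> * complex_of_real y)))"
    and upos: "Im (f (\<i> * complex_of_real y)) > 0" if "y \<in> S" for y
    using that im by (auto simp: imag_line_def image_subset_iff)
  have Oiy: "\<Omega> (\<i> * complex_of_real y) = \<i> * complex_of_real (w y)" if "y \<in> S" for y
    unfolding \<Omega>_def using reO[OF that]
    by (subst reO[OF that]) (simp add: w_def T_def algebra_simps)
  show wge: "w y \<ge> y" if y: "y > 0" for y
  proof -
    have "f (\<i> * complex_of_real y) = F_transform \<mu> (\<i> * complex_of_real y)"
      using V y by (auto simp: imag_line_def)
    then have "Im (f (\<i> * complex_of_real y)) \<ge> y"
      using \<mu>.Im_F_transform_ge[of "\<i> * complex_of_real y"] y by simp
    then have "t * Im (f (\<i> * complex_of_real y)) \<ge> t * y" using t by (intro mult_left_mono) auto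
    then show ?thesis by (simp add: w_def algebra_simps)
  qed
  \<comment> \<open>Positivity has two sources: \<open>w y \<ge> y\<close> when
    \<open>y > 0\<close>, and for \<open>y \<le> 0\<close> the positivity of \<open>Im f\<close> on
    the axis together with \<open>- (t - 1) * y \<ge> 0\<close>.\<close>
  have wpos: "w y > 0" if "y \<in> S" for y
  proof (cases "y > 0")
    case True
    then show ?thesis using wge[of y] by simp
  next
    case False
    have "t * Im (f (\<i> * complex_of_real y)) > 0" using upos[OF that] t by simp
    moreover have "(t - 1) * y \<le> 0" using False t by (simp add: mult_nonneg_nonpos)
    ultimately show ?thesis by (simp add: w_def)
  qed
  show "continuous_on S w"
    unfolding w_def using U(2)
    by (intro continuous_intros continuous_on_compose2[OF holomorphic_on_imp_continuous_on[OF U(3)]])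
      (auto simp: imag_line_def)
  \<comment> \<open>The left inverse \<open>k\<close> is holomorphic on the upper half-plane, so the
    continuation takes place where \<open>\<Omega>\<close> has positive imaginary part, on the
    component of \<open>\<i>\<close>, which contains all of \<open>imag_line S\<close>.\<close>
  define W where "W = {z \<in> U. Im (\<Omega> z) > 0}"
  have Weq: "W = U \<inter> \<Omega> -` {z. Im z > 0}" by (auto simp: W_def)
  have opW: "open W"
    unfolding Weq by (rule continuous_open_preimage[OF holomorphic_on_imp_continuous_on[OF holO] U(1) open_halfspace_Im_gt])
  have lineW: "imag_line S \<subseteq> W"
    using U(2) Oiy wpos by (auto simp: W_def imag_line_def)
  define C where "C = connected_component_set W \<i>"
  have iS: "\<i> \<in> imag_line S" "\<i> \<in> V" 
    using subsetD[OF S(2), of 1] V(2) by (auto simp: imag_line_def image_subset_iff intro!: image_eqI[of _ _ 1] dest: bspec[of _ _ 1])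
  have opC: "open C" unfolding C_def by (rule open_connected_component[OF opW])
  have connC: "connected C" unfolding C_def by simp
  have CW: "C \<subseteq> W" unfolding C_def by (rule connected_component_subset)
  have lineC: "imag_line S \<subseteq> C"
    unfolding C_def
  proof (rule connected_component_maximal[OF iS(1) _ lineW])
    show "connected (imag_line S)"
      unfolding imag_line_def by (intro connected_continuous_image continuous_intros S(1))
  qed
  \<comment> \<open>From \<open>F_transform \<nu> (\<Omega> z) = F_transform \<rho> z\<close> and
    \<open>(1 + T) * \<Omega> z = z + T * F_transform \<rho> z\<close> one recovers \<open>z\<close>
    as \<open>k (\<Omega> z)\<close>.\<close>
  define k where "k z = (1 + T) * z - T * F_transform \<nu> z" for z
  have holk: "k holomorphic_on {z. Im z > 0}"
    unfolding k_def by (intro holomorphic_intros \<nu>.F_transform_holomorphic)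
  have kO: "(k \<circ> \<Omega>) z = z" if z: "z \<in> C" for z
  proof (rule analytic_continuation_open[where s = "C \<inter> V \<inter> {z. Im z > 0}" and s' = C and g = "\<lambda>z. z"])
    show "open (C \<inter> V \<inter> {z. Im z > 0})" by (intro open_Int opC V(1) open_halfspace_Im_gt)
    have "\<i> \<in> C \<inter> V \<inter> {z. Im z > 0}" using iS lineC by auto
    then show "C \<inter> V \<inter> {z. Im z > 0} \<noteq> {}" by blast
    show "k \<circ> \<Omega> holomorphic_on C"
      using CW by (intro holomorphic_on_compose_gen[OF holomorphic_on_subset[OF holO] holk]) (auto simp: W_def)
    fix z assume "z \<in> C \<inter> V \<inter> {z. Im z > 0}"
    then have z: "Im z > 0" "f z = F_transform \<mu> z" using V(3) by auto
    have "(z + T * F_transform \<rho> z) / (1 + T) = \<Omega> z"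
    proof -
      have "z + T * F_transform \<rho> z = (1 + T) * \<Omega> z"
        unfolding F\<rho>[OF z(1)] \<Omega>_def z(2) by (simp add: algebra_simps)
      then show ?thesis using T1 by simp
    qed
    then have "F_transform \<nu> (\<Omega> z) = (1 + T) * F_transform \<mu> z - T * z"
      using sub[OF z(1)] F\<rho>[OF z(1)] by simp
    then have "(k \<circ> \<Omega>) z = (1 + T) * \<Omega> z - T * ((1 + T) * F_transform \<mu> z - T * z)"
      by (simp add: k_def)
    then show "(k \<circ> \<Omega>) z = z"
      by (simp add: \<Omega>_def z(2) algebra_simps)
  qed (use opC connC z in auto)
  show "inj_on w S"
  proof (rule inj_onI)
    fix x y assume xy: "x \<in> S" "y \<in> S" "w x = w y"
    have "k (\<i> * complex_of_real (w y)) = \<i> * complex_of_real y" if "y \<in> S" for y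
    proof -
      have "\<i> * complex_of_real y \<in> C" using lineC that by (auto simp: imag_line_def)
      from kO[OF this] show ?thesis by (simp only: o_apply Oiy[OF that])
    qed
    then have "\<i> * complex_of_real x = \<i> * complex_of_real y"
      using xy by metis
    then show "x = y" by simp
  qed
qed

text \<open>After a drop from \<open>x\<close> to \<open>y\<close>, the growth
  \<open>w v \<ge> v\<close> forces \<open>w\<close> back up to the value \<open>w x\<close> beyond
  \<open>y\<close>, by the intermediate value theorem; injectivity forbids this.\<close>

lemma not_decreasing_of_inj_on_ray:
  fixes w :: "real \<Rightarrow> real"
  assumes inj: "inj_on w S" and cont: "continuous_on S w" and ge: "\<And>y. y > 0 \<Longrightarrow> w y \<ge> y"
    and up: "\<And>x y. x \<in> S \<Longrightarrow> x \<le> y \<Longrightarrow> y \<in> S"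
    and xy: "x \<in> S" "x < y"
  shows "w x \<le> w y"
proof (rule ccontr)
  assume less: "\<not> w x \<le> w y"
  define v where "v = Max {y, 1, w x}"
  have v: "y \<le> v" "v > 0" "w x \<le> v" by (auto simp: v_def less_max_iff_disj)
  have "continuous_on {y..v} w"
    using up[OF xy(1)] xy(2) by (intro continuous_on_subset[OF cont]) auto
  moreover have "w y \<le> w x" "w x \<le> w v" using less v ge[of v] by auto
  ultimately obtain u where u: "y \<le> u" "u \<le> v" "w u = w x"
    using IVT'[of w y "w x" v] v(1) by blast
  then have "u = x" using inj up[OF xy(1), of u] xy by (auto dest!: inj_onD)
  then show False using u xy by simp
qed

lemma BB_range_le_1_line:
  assumes \<mu>: "real_distribution \<mu>" and BB: "\<mu> \<in> BB_range t"
    and ext: "extends_F f \<mu>" and uni: "univalent_around f (imag_line UNIV)"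
    and im: "f ` imag_line UNIV = imag_line {0<..}"
  shows "t \<le> 1"
proof (rule ccontr)
  assume "\<not> t \<le> 1"
  then have t: "t > 1" by simp
  obtain U where U: "open U" "imag_line UNIV \<subseteq> U" "f holomorphic_on U"
    using uni by (auto simp: univalent_around_def)
  define w where "w y = t * Im (f (\<i> * complex_of_real y)) - (t - 1) * y" for y
  have w: "inj_on w UNIV" "continuous_on UNIV w" "\<And>y. y > 0 \<Longrightarrow> w y \<ge> y"
    using BB_range_imp_inj_on[OF \<mu> BB _ ext U, folded w_def] im t by auto
  \<comment> \<open>\<open>x\<close> is chosen so that \<open>- (t - 1) * x\<close> alone exceeds
    \<open>w 0\<close>; the term with \<open>Im f\<close> is positive, so \<open>w x > w 0\<close>
    although \<open>x < 0\<close>.\<close>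
  define x where "x = - (\<bar>w 0\<bar> + 1) / (t - 1)"
  have x: "x < 0" "(t - 1) * x = - (\<bar>w 0\<bar> + 1)" using t by (auto simp: x_def divide_neg_pos)
  have "f (\<i> * complex_of_real x) \<in> imag_line {0<..}" using im by (auto simp: imag_line_def)
  then have "t * Im (f (\<i> * complex_of_real x)) > 0" using t by (auto simp: imag_line_def)
  then have "w x > w 0" unfolding w_def[of x] x(2) by linarith
  moreover have "w x \<le> w 0"
    using not_decreasing_of_inj_on_ray[OF w _ _ x(1)] by auto
  ultimately show False by simp
qed

lemma BB_range_le_1_ray:
  assumes \<mu>: "real_distribution \<mu>" and BB: "\<mu> \<in> BB_range t"
    and ext: "extends_F f \<mu>" and uni: "univalent_around f (imag_line {c<..})"
    and im: "f ` imag_line {c<..} = imag_line {0<..}" and c: "c \<le> 0"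
    and der: "((\<lambda>y. deriv f (\<i> * complex_of_real y)) \<longlongrightarrow> 0) (at_right c)"
  shows "t \<le> 1"
proof (rule ccontr)
  assume "\<not> t \<le> 1"
  then have t: "t > 1" by simp
  obtain U where U: "open U" "imag_line {c<..} \<subseteq> U" "f holomorphic_on U"
    using uni by (auto simp: univalent_around_def)
  define w where "w y = t * Im (f (\<i> * complex_of_real y)) - (t - 1) * y" for y
  have w: "inj_on w {c<..}" "continuous_on {c<..} w" "\<And>y. y > 0 \<Longrightarrow> w y \<ge> y"
    using BB_range_imp_inj_on[OF \<mu> BB _ ext U, folded w_def] im t c by auto
  have dw: "(w has_real_derivative t * Re (deriv f (\<i> * complex_of_real y)) - (t - 1)) (at y)" if "y > c" for y
  proof -
    have "(f has_field_derivative deriv f (\<i> * complex_of_real y)) (at (\<i> * complex_of_real y))"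
      using that U by (intro holomorphic_derivI[OF U(3,1)]) (auto simp: imag_line_def)
    moreover have "((\<lambda>y. \<i> * complex_of_real y) has_vector_derivative \<i>) (at y)"
      by (auto intro!: derivative_eq_intros simp: has_vector_derivative_def scaleR_conv_of_real mult.commute)
    ultimately have "((f \<circ> (\<lambda>y. \<i> * complex_of_real y)) has_vector_derivative \<i> * deriv f (\<i> * complex_of_real y)) (at y)"
      using field_vector_diff_chain_at by blast
    from bounded_linear.has_vector_derivative[OF bounded_linear_Im this]
    have "((\<lambda>y. Im (f (\<i> * complex_of_real y))) has_real_derivative Re (deriv f (\<i> * complex_of_real y))) (at y)"
      by (simp add: has_real_derivative_iff_has_vector_derivative o_def)
    then show ?thesis
      unfolding w_def by (intro DERIV_diff DERIV_cmult DERIV_cmult_Id)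
  qed
  have "((\<lambda>y. Re (deriv f (\<i> * complex_of_real y))) \<longlongrightarrow> 0) (at_right c)"
    using tendsto_Re[OF der] by simp
  \<comment> \<open>The derivative \<open>t * Re (deriv f (\<i> * y)) - (t - 1)\<close> of
    \<open>w\<close> is negative exactly when the real part lies below \<open>(t - 1) / t\<close>,
    which is positive as \<open>t > 1\<close>.\<close>
  from order_tendstoD(2)[OF this, of "(t - 1) / t"] t
  obtain b where b: "b > c" "\<And>y. c < y \<Longrightarrow> y < b \<Longrightarrow> Re (deriv f (\<i> * complex_of_real y)) < (t - 1) / t"
    by (auto simp: eventually_at_right_field)
  obtain x where x: "c < x" "x < b" using dense[OF b(1)] by blast
  obtain y where y: "x < y" "y < b" using dense[OF x(2)] by blast
  have "w y < w x"
  proof (rule DERIV_neg_imp_decreasing[OF y(1)])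
    fix v assume v: "x \<le> v" "v \<le> y"
    have "Re (deriv f (\<i> * complex_of_real v)) < (t - 1) / t" using b(2)[of v] v x y by auto
    then have "t * Re (deriv f (\<i> * complex_of_real v)) - (t - 1) < 0"
      using t by (simp add: pos_less_divide_eq mult.commute)
    then show "\<exists>D. (w has_real_derivative D) (at v) \<and> D < 0"
      using dw[of v] v x by auto
  qed
  moreover have "w x \<le> w y"
    using not_decreasing_of_inj_on_ray[OF w _ _ y(1)] x by auto
  ultimately show False by simp
qed

section \<open>The value of the indicator\<close>

theorem lemma7p1:
  fixes \<mu> :: "real measure"
  assumes "real_distribution \<mu>"
    and "symmetric_measure \<mu>"
    and "FID \<mu>"
    and "(\<exists>f. extends_F f \<mu> \<and> univalent_around f (imag_line UNIV) \<and>
              f ` imag_line UNIV = imag_line {0<..})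
       \<or> (\<exists>c\<le>0. \<exists>f. extends_F f \<mu> \<and> univalent_around f (imag_line {c<..}) \<and>
              f ` imag_line {c<..} = imag_line {0<..} \<and>
              ((\<lambda>y. deriv f (\<i> * complex_of_real y)) \<longlongrightarrow> 0) (at_right c))"
  shows "free_div_indicator \<mu> = 1"
proof (rule antisym)
  have "t \<le> 1" if "\<mu> \<in> BB_range t" for t
    using assms(4) BB_range_le_1_line[OF assms(1) that] BB_range_le_1_ray[OF assms(1) that] by blast
  then show "free_div_indicator \<mu> \<le> 1"
    unfolding free_div_indicator_def
    by (intro SUP_least) (use ennreal_leI in fastforce)
next
  \<comment> \<open>Free roots of every order \<open>Suc n\<close> give the admissible parameters
    \<open>1 - 1 / Suc n\<close>, which tend to \<open>1\<close>; the first order is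
    \<open>1\<close>, with parameter \<open>0\<close>.\<close>
  have "ennreal (1 - 1 / real (Suc n)) \<le> free_div_indicator \<mu>" for n
  proof -
    obtain \<nu> where "real_distribution \<nu>" "is_free_conv_iter \<nu> (Suc n) \<mu>"
      using assms(3) by (auto simp: FID_def)
    then have "\<mu> \<in> BB_range (1 - 1 / real (Suc n))"
      by (intro free_conv_iter_imp_BB_range) auto
    then show ?thesis
      unfolding free_div_indicator_def by (intro SUP_upper) auto
  qed
  moreover have "(\<lambda>n. ennreal (1 - 1 / real (Suc n))) \<longlonglongrightarrow> ennreal 1"
    by (intro tendsto_ennrealI) real_asymp
  ultimately show "1 \<le> free_div_indicator \<mu>"
    by (intro LIMSEQ_le_const2[where X = "\<lambda>n. ennreal (1 - 1 / real (Suc n))"]) auto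
qed

end
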